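(* Let $G$ be a connected metric graph with $\ell(G)$ leaves, cyclomatic number $\mathrm{cyc}(G)$, total length $\mathrm{len}(G)$ and diameter $\mathrm{diam}(G)$. Then $$\mathrm{len}(G) \le \Big(\mathrm{cyc}(G) + \max\big\{1, \tfrac{\ell(G)}{2}\big\}\Big)\cdot \mathrm{diam}(G).$$
   Context: A metric graph is the compact metric space obtained from a finite collection of compact intervals (edges) of positive length by identifying their endpoints in groups (the vertices); equivalently, it is a finite edge-weighted multigraph (loops and parallel edges allowed) in which all points in the interior of each edge are included and each edge is locally isometric to an interval whose length is the edge weight. Metric graphs are assumed connected. The distance $d_G(x,y)$ is the minimum length of a path in $G$ from $x$ to $y$. The diameter is $\mathrm{diam}(G)=\max_{x,y\in G} d_G(x,y)$, over all points of $G$ (not only vertices). The length $\mathrm{len}(G)$ is the sum of the lengths of the edges. A leaf is a vertex of degree one (a point having a small neighborhood homeomorphic to an interval with that point as an endpoint), and $\ell(G)$ is the number of leaves. The cyclomatic number is $\mathrm{cyc}(G)=|E|-|V|+1$ for any combinatorial graph $(V,E)$ describing $G$ (equivalently the first Betti number of $G$). *)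

theory Defs
  imports "HOL-Analysis.Analysis" "Graph_Theory.Graph_Theory"
begin

text \<open>
  A metric graph is presented by a finite connected multigraph (loops and parallel edges allowed)
  with positive edge lengths.  The multigraph is a \<^typ>\<open>('a, 'b) pre_digraph\<close>: the direction of
  an arc is only an arbitrary choice of the parametrization of that edge by \<open>{0..w e}\<close>, from its
  tail to its head.  \<open>Digraph_Component.connected\<close> is connectedness of the underlying undirected
  graph (and includes that there is at least one vertex).
\<close>

locale metric_graph = fin_digraph G for G :: "('a, 'b) pre_digraph" (structure) +
  fixes w :: "'b \<Rightarrow> real"
  assumes connected: "Digraph_Component.connected G"
    and edge_pos: "e \<in> arcs G \<Longrightarrow> 0 < w e"

text \<open>
  The points of the metric graph are the vertices and the interior points of the edges;
  \<open>edge_point G w e\<close> is the map from the interval \<open>{0..w e}\<close> to the metric graph that glues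
  the two endpoints of the interval to vertices.
\<close>

datatype ('a, 'b) gpoint = Vertex 'a | Interior 'b real

definition gpoints :: "('a, 'b) pre_digraph \<Rightarrow> ('b \<Rightarrow> real) \<Rightarrow> ('a, 'b) gpoint set" where
  "gpoints G w = Vertex ` verts G \<union> {Interior e t |e t. e \<in> arcs G \<and> 0 < t \<and> t < w e}"

definition edge_point ::
    "('a, 'b) pre_digraph \<Rightarrow> ('b \<Rightarrow> real) \<Rightarrow> 'b \<Rightarrow> real \<Rightarrow> ('a, 'b) gpoint" where
  "edge_point G w e t =
     (if t = 0 then Vertex (tail G e) else if t = w e then Vertex (head G e) else Interior e t)"

text \<open>
  A path is given as a finite list of segments \<open>(e, s, t)\<close>, each running along the edge \<open>e\<close> from
  the parameter \<open>s\<close> to the parameter \<open>t\<close> (in either direction), each segment starting at the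
  point where the previous one ends.
\<close>

fun gpath :: "('a, 'b) pre_digraph \<Rightarrow> ('b \<Rightarrow> real) \<Rightarrow>
    ('a, 'b) gpoint \<Rightarrow> ('b \<times> real \<times> real) list \<Rightarrow> ('a, 'b) gpoint \<Rightarrow> bool" where
  "gpath G w x [] y \<longleftrightarrow> x \<in> gpoints G w \<and> x = y"
| "gpath G w x ((e, s, t) # p) y \<longleftrightarrow>
     e \<in> arcs G \<and> s \<in> {0..w e} \<and> t \<in> {0..w e} \<and> x = edge_point G w e s \<and>
     gpath G w (edge_point G w e t) p y"

definition gpath_length :: "('b \<times> real \<times> real) list \<Rightarrow> real" where
  "gpath_length p = (\<Sum>(e, s, t)\<leftarrow>p. \<bar>t - s\<bar>)"

definition gdist :: "('a, 'b) pre_digraph \<Rightarrow> ('b \<Rightarrow> real) \<Rightarrow>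
    ('a, 'b) gpoint \<Rightarrow> ('a, 'b) gpoint \<Rightarrow> real" where
  "gdist G w x y = Inf {gpath_length p |p. gpath G w x p y}"

definition gdiam :: "('a, 'b) pre_digraph \<Rightarrow> ('b \<Rightarrow> real) \<Rightarrow> real" where
  "gdiam G w = (SUP (x, y) \<in> gpoints G w \<times> gpoints G w. gdist G w x y)"

definition glen :: "('a, 'b) pre_digraph \<Rightarrow> ('b \<Rightarrow> real) \<Rightarrow> real" where
  "glen G w = (\<Sum>e\<in>arcs G. w e)"

text \<open>A loop is both an in-arc and an out-arc, so it counts twice towards the degree.\<close>

definition gdegree :: "('a, 'b) pre_digraph \<Rightarrow> 'a \<Rightarrow> nat" where
  "gdegree G v = in_degree G v + out_degree G v"

definition num_leaves :: "('a, 'b) pre_digraph \<Rightarrow> nat" where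
  "num_leaves G = card {v \<in> verts G. gdegree G v = 1}"

definition cyc :: "('a, 'b) pre_digraph \<Rightarrow> int" where
  "cyc G = int (card (arcs G)) - int (card (verts G)) + 1"


text \<open>
  Sanity checks: the points with \<^const>\<open>gdist\<close> form a metric space of finite diameter.  In
  particular the infimum and the supremum above are taken over nonempty bounded sets.
\<close>

lemma gpath_length_simps [simp]:
  "gpath_length [] = 0"
  "gpath_length ((e, s, t) # p) = \<bar>t - s\<bar> + gpath_length p"
  "gpath_length (p @ q) = gpath_length p + gpath_length q"
  by (auto simp: gpath_length_def)

lemma gpath_length_nonneg: "0 \<le> gpath_length p"
  by (induction p) auto

lemma gpath_append: "gpath G w x p y \<Longrightarrow> gpath G w y q z \<Longrightarrow> gpath G w x (p @ q) z"
  by (induction G w x p y rule: gpath.induct) auto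

lemma gdist_le: "gpath G w x p y \<Longrightarrow> gdist G w x y \<le> gpath_length p"
  unfolding gdist_def
  by (rule cInf_lower) (auto intro!: bdd_belowI[where m = 0] gpath_length_nonneg)

lemma gpath_lipschitz:
  assumes "\<And>e s t. e \<in> arcs G \<Longrightarrow> s \<in> {0..w e} \<Longrightarrow> t \<in> {0..w e} \<Longrightarrow>
      f (edge_point G w e t) - f (edge_point G w e s) \<le> \<bar>t - s\<bar>"
    and "gpath G w x p y"
  shows "f y - f x \<le> gpath_length p"
  using assms(2)
proof (induction p arbitrary: x)
  case (Cons a p)
  obtain e s t where a: "a = (e, s, t)" by (cases a)
  have "f y - f (edge_point G w e t) \<le> gpath_length p"
    using Cons a by auto
  moreover have "f (edge_point G w e t) - f x \<le> \<bar>t - s\<bar>"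
    using Cons.prems a assms(1)[of e s t] by auto
  ultimately show ?case by (simp add: a)
qed simp

context metric_graph
begin

lemma edge_point_in: "e \<in> arcs G \<Longrightarrow> t \<in> {0..w e} \<Longrightarrow> edge_point G w e t \<in> gpoints G w"
  by (auto simp: edge_point_def gpoints_def)

lemma gpath_segment:
  assumes "e \<in> arcs G" "s \<in> {0..w e}" "t \<in> {0..w e}"
  shows "gpath G w (edge_point G w e s) [(e, s, t)] (edge_point G w e t)"
  using assms edge_point_in by auto

lemma gpath_rev:
  "gpath G w x p y \<Longrightarrow> \<exists>q. gpath G w y q x \<and> gpath_length q = gpath_length p"
proof (induction p arbitrary: x)
  case Nil
  then show ?case by (intro exI[of _ "[]"]) auto
next
  case (Cons a p)
  obtain e s t where a: "a = (e, s, t)" by (cases a)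
  obtain q where "gpath G w y q (edge_point G w e t)" "gpath_length q = gpath_length p"
    using Cons a by auto
  moreover have "gpath G w (edge_point G w e t) [(e, t, s)] x"
    using Cons.prems a gpath_segment[of e t s] by auto
  ultimately have "gpath G w y (q @ [(e, t, s)]) x \<and>
      gpath_length (q @ [(e, t, s)]) = gpath_length (a # p)"
    by (auto intro: gpath_append simp: a simp del: gpath.simps)
  then show ?case by blast
qed

lemma gpath_vertices:
  assumes "u \<in> verts G" "v \<in> verts G"
  shows "\<exists>p. gpath G w (Vertex u) p (Vertex v)"
proof -
  have "u \<rightarrow>\<^sup>*\<^bsub>with_proj (mk_symmetric G)\<^esub> v"
    using connected assms by (auto simp: Digraph_Component.connected_def strongly_connected_def
        mk_symmetric_def)
  then show ?thesis
    unfolding reachable_def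
  proof (induction rule: rtrancl_on_induct)
    case base
    show ?case using assms by (intro exI[of _ "[]"]) (auto simp: gpoints_def)
  next
    case (step x y)
    then obtain p where p: "gpath G w (Vertex u) p (Vertex x)" by auto
    obtain e where e: "e \<in> arcs G" "(x, y) = (tail G e, head G e) \<or> (x, y) = (head G e, tail G e)"
      using step by (auto simp: mk_symmetric_def arcs_ends_def arc_to_ends_def)
    have "0 < w e" using e edge_pos by auto
    then have "\<exists>q. gpath G w (Vertex x) q (Vertex y)"
      using e gpath_segment[of e 0 "w e"] gpath_segment[of e "w e" 0]
      by (auto simp: edge_point_def simp del: gpath.simps)
    then show ?case using p gpath_append by blast
  qed
qed

lemma gpath_to_vertex:
  assumes "x \<in> gpoints G w"
  shows "\<exists>v\<in>verts G. \<exists>p. gpath G w x p (Vertex v) \<and> gpath_length p \<le> glen G w"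
proof (cases x)
  case (Vertex v)
  have "0 \<le> glen G w" unfolding glen_def by (intro sum_nonneg) (use edge_pos in force)
  then show ?thesis using Vertex assms
    by (intro bexI[of _ v] exI[of _ "[]"]) (auto simp: gpoints_def)
next
  case (Interior e t)
  then have e: "e \<in> arcs G" "0 < t" "t < w e" using assms by (auto simp: gpoints_def)
  have "w e \<le> glen G w"
    unfolding glen_def using e edge_pos by (intro member_le_sum) (auto intro: less_imp_le)
  then show ?thesis using e Interior gpath_segment[of e t 0]
    by (intro bexI[of _ "tail G e"] exI[of _ "[(e, t, 0)]"]) (auto simp: edge_point_def)
qed

lemma gpath_exists_bounded:
  "\<exists>B. \<forall>x\<in>gpoints G w. \<forall>y\<in>gpoints G w. \<exists>p. gpath G w x p y \<and> gpath_length p \<le> B"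
proof -
  obtain P where P: "\<And>u v. u \<in> verts G \<Longrightarrow> v \<in> verts G \<Longrightarrow> gpath G w (Vertex u) (P u v) (Vertex v)"
    using gpath_vertices by metis
  define M where "M = (\<Sum>(u, v)\<in>verts G \<times> verts G. gpath_length (P u v))"
  have M: "gpath_length (P u v) \<le> M" if "u \<in> verts G" "v \<in> verts G" for u v
    using member_le_sum[of "(u, v)" "verts G \<times> verts G" "\<lambda>(u, v). gpath_length (P u v)"] that
    by (auto simp: M_def gpath_length_nonneg)
  show ?thesis
  proof (intro exI[of _ "glen G w + M + glen G w"] ballI)
    fix x y assume "x \<in> gpoints G w" "y \<in> gpoints G w"
    then obtain u p v q where uv: "u \<in> verts G" "v \<in> verts G"
      and p: "gpath G w x p (Vertex u)" "gpath_length p \<le> glen G w"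
      and q: "gpath G w (Vertex v) q y" "gpath_length q \<le> glen G w"
      by (metis gpath_to_vertex gpath_rev)
    have "gpath G w x ((p @ P u v) @ q) y"
      using p q P uv by (blast intro: gpath_append)
    then show "\<exists>p. gpath G w x p y \<and> gpath_length p \<le> glen G w + M + glen G w"
      using p q M[OF uv] by (intro exI[of _ "(p @ P u v) @ q"]) simp
  qed
qed

lemma gdist_greatest:
  assumes "x \<in> gpoints G w" "y \<in> gpoints G w"
    and "\<And>p. gpath G w x p y \<Longrightarrow> c \<le> gpath_length p"
  shows "c \<le> gdist G w x y"
  unfolding gdist_def using assms gpath_exists_bounded by (intro cInf_greatest) blast+

lemma gdist_nonneg: "x \<in> gpoints G w \<Longrightarrow> y \<in> gpoints G w \<Longrightarrow> 0 \<le> gdist G w x y"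
  by (rule gdist_greatest) (auto simp: gpath_length_nonneg)

lemma gdist_commute: "gdist G w x y = gdist G w y x"
proof -
  have "{gpath_length p |p. gpath G w x p y} = {gpath_length p |p. gpath G w y p x}"
    using gpath_rev by (auto; metis)
  then show ?thesis by (simp add: gdist_def)
qed

lemma gdist_triangle:
  assumes "x \<in> gpoints G w" "y \<in> gpoints G w" "z \<in> gpoints G w"
  shows "gdist G w x z \<le> gdist G w x y + gdist G w y z"
proof -
  have "gdist G w x z - gpath_length q \<le> gdist G w x y" if q: "gpath G w y q z" for q
  proof (rule gdist_greatest[OF assms(1,2)])
    fix p assume "gpath G w x p y"
    from gdist_le[OF gpath_append[OF this q]]
    show "gdist G w x z - gpath_length q \<le> gpath_length p" by simp
  qed
  then have "gdist G w x z - gdist G w x y \<le> gdist G w y z"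
    by (intro gdist_greatest assms(2,3)) (simp add: algebra_simps)
  then show ?thesis by simp
qed

lemma gdist_pos_Interior:
  assumes "Interior e t \<in> gpoints G w" "y \<in> gpoints G w" "y \<noteq> Interior e t"
  shows "0 < gdist G w (Interior e t) y"
proof -
  have e: "e \<in> arcs G" "0 < t" "t < w e" using assms by (auto simp: gpoints_def)
  define m where "m = min t (w e - t)"
  define f where "f x = (case x of Vertex v \<Rightarrow> m
    | Interior e' s \<Rightarrow> if e' = e then min m \<bar>s - t\<bar> else m)" for x :: "('a, 'b) gpoint"
  have f_edge: "f (edge_point G w e' s) = (if e' = e then min m \<bar>s - t\<bar> else m)"
    if "s \<in> {0..w e'}" for e' s
    using that e by (auto simp: edge_point_def f_def m_def)
  have "f y - f (Interior e t) \<le> gdist G w (Interior e t) y"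
    using assms
    by (intro gdist_greatest gpath_lipschitz[where f = f and G = G and w = w]) (auto simp: f_edge)
  moreover have "f (Interior e t) = 0" "0 < f y"
    using e assms(3) by (auto simp: f_def m_def split: gpoint.split)
  ultimately show ?thesis by simp
qed

lemma gdist_pos_Vertex:
  assumes "Vertex u \<in> gpoints G w" "Vertex v \<in> gpoints G w" "u \<noteq> v"
  shows "0 < gdist G w (Vertex u) (Vertex v)"
proof -
  define m where "m = Min (insert 1 (w ` arcs G))"
  have m: "0 < m" "\<And>e. e \<in> arcs G \<Longrightarrow> m \<le> w e"
    using edge_pos by (auto simp: m_def)
  define g where "g x = (if x = u then 0 else m)" for x
  define f where "f x = (case x of Vertex x \<Rightarrow> g x
    | Interior e s \<Rightarrow> min (g (tail G e) + s) (g (head G e) + (w e - s)))" for x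
  have f_edge: "f (edge_point G w e s) = min (g (tail G e) + s) (g (head G e) + (w e - s))"
    if "e \<in> arcs G" for e s
    using m(1) m(2)[OF that] by (auto simp: edge_point_def f_def g_def)
  have "f (Vertex v) - f (Vertex u) \<le> gdist G w (Vertex u) (Vertex v)"
    using assms
    by (intro gdist_greatest gpath_lipschitz[where f = f and G = G and w = w]) (auto simp: f_edge)
  then show ?thesis using assms m by (auto simp: f_def g_def)
qed

theorem Metric_space_gdist:
  "Metric_space (gpoints G w) (\<lambda>x y. if x \<in> gpoints G w \<and> y \<in> gpoints G w then gdist G w x y else 0)"
    (is "Metric_space _ ?d")
proof
  show "?d x z \<le> ?d x y + ?d y z" if "x \<in> gpoints G w" "y \<in> gpoints G w" "z \<in> gpoints G w"
    for x y z
    using that gdist_triangle by simp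
  show "0 \<le> ?d x y" for x y by (simp add: gdist_nonneg)
  show "?d x y = ?d y x" for x y using gdist_commute[of x y] by simp
  fix x y
  assume xy: "x \<in> gpoints G w" "y \<in> gpoints G w"
  have "gdist G w x x = 0"
    using xy gdist_le[of G w x "[]" x] gdist_nonneg[of x x] by auto
  moreover have "0 < gdist G w x y" if "x \<noteq> y"
    using that xy gdist_pos_Interior gdist_pos_Vertex gdist_commute
    by (cases x; cases y) metis+
  ultimately show "?d x y = 0 \<longleftrightarrow> x = y"
    using xy by fastforce
qed

theorem gdist_le_gdiam:
  assumes "x \<in> gpoints G w" "y \<in> gpoints G w"
  shows "gdist G w x y \<le> gdiam G w"
proof -
  obtain B where B: "\<forall>x\<in>gpoints G w. \<forall>y\<in>gpoints G w. \<exists>p. gpath G w x p y \<and> gpath_length p \<le> B"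
    using gpath_exists_bounded by blast
  have "gdist G w x y \<le> B" if "x \<in> gpoints G w" "y \<in> gpoints G w" for x y
    using B that gdist_le[of G w x _ y] by (blast intro: order_trans)
  then have "bdd_above ((\<lambda>(x, y). gdist G w x y) ` (gpoints G w \<times> gpoints G w))"
    by (intro bdd_aboveI[of _ B]) auto
  then show ?thesis
    unfolding gdiam_def
    using assms cSUP_upper[of "(x, y)" "gpoints G w \<times> gpoints G w" "\<lambda>(x, y). gdist G w x y"]
    by auto
qed

end

end

theory Submission
  imports Defs
begin

text \<open>
  Let \<open>f\<close> be the distance from a root vertex, chosen to be a leaf if there is one, and fix a tree of
  geodesics to the root.  Each of the \<open>g = cyc G\<close> arcs outside the tree is cut at its highest point;
  these peaks and the leaves other than the root are the tops, and every component of a superlevel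
  set \<open>{f > t}\<close> contains one.  The number of points at height \<open>t\<close> is the Euler characteristic of
  \<open>{f > t}\<close> plus the number of peaks above \<open>t\<close>, and integrating it over \<open>t\<close> gives the length.

  Let \<open>s(y, z)\<close> be the largest height that a path from \<open>y\<close> to \<open>z\<close> need not go below.  Start with the
  highest leaf top \<open>y\<^sub>0\<close> (any vertex if there is none) and enumerate the peaks greedily: \<open>y\<^sub>i\<^sub>+\<^sub>1\<close>
  minimizes \<open>f y - s(y, y\<^sub>i)\<close> among the remaining peaks \<open>y\<close>.  Put \<open>m\<^sub>i = s(y\<^sub>i\<^sub>+\<^sub>1, y\<^sub>i)\<close> and
  \<open>\<delta>\<^sub>i = f y\<^sub>i + f y\<^sub>i\<^sub>+\<^sub>1 - m\<^sub>i - D\<close>, where \<open>D\<close> is the diameter.  Every \<open>i\<close> with \<open>m\<^sub>i > t\<close> makes one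
  of the tops above \<open>t\<close> redundant in the count of the components of \<open>{f > t}\<close>.  The key point is
  that cutting \<open>{f > t}\<close> at all peaks \<open>y\<^sub>i\<^sub>+\<^sub>1\<close>
  with \<open>\<delta>\<^sub>i > t\<close> does not disconnect any component, so that \<open>{f > t}\<close> has at least as many independent
  cycles: otherwise take the first such \<open>i\<close> whose peak lies on the boundary of a piece; by greediness
  all cut points on that boundary are at least as far from \<open>y\<^sub>i\<close> as \<open>y\<^sub>i\<^sub>+\<^sub>1\<close> is, and a suitable point of
  the piece on the other side has distance at least \<open>\<delta>\<^sub>i + D - t > D\<close> from \<open>y\<^sub>i\<close>.  Integrating,
  the sum of \<open>m\<^sub>i + \<delta>\<^sub>i\<close> telescopes, and the length is at most \<open>g D + D\<close> plus \<open>D / 2\<close> for each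
  top leaf other than \<open>y\<^sub>0\<close>.
\<close>

section \<open>Counting lemmas\<close>

text \<open>Grow a vertex set from \<open>S\<close> along crossing edges: each new vertex makes at
  least one more edge internal, so a largest set obeying this count is all of \<open>V\<close>. The
  hypothesis \<open>crossing\<close> says that \<open>S\<close> meets every component.\<close>

lemma card_le_card_plus_card_edges:
  fixes a b :: "'e \<Rightarrow> 'v"
  assumes "finite V" "finite X" "S \<subseteq> V"
    and ends: "\<And>x. x \<in> X \<Longrightarrow> a x \<in> V \<and> b x \<in> V"
    and crossing: "\<And>A. S \<subseteq> A \<Longrightarrow> A \<subset> V \<Longrightarrow> \<exists>x\<in>X. (a x \<in> A) \<noteq> (b x \<in> A)"
  shows "card V \<le> card S + card X"
proof -
  define inner where "inner A = {x \<in> X. a x \<in> A \<and> b x \<in> A}" for A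
  define P where "P A \<longleftrightarrow> S \<subseteq> A \<and> A \<subseteq> V \<and> card A \<le> card S + card (inner A)" for A
  have "P S" using assms by (auto simp: P_def)
  moreover have "\<forall>A. P A \<longrightarrow> card A < Suc (card V)"
    using \<open>finite V\<close> by (auto simp: P_def less_Suc_eq_le intro: card_mono)
  ultimately obtain A where A: "P A" and max: "\<And>B. P B \<Longrightarrow> card B \<le> card A"
    using ex_has_greatest_nat[of P S card "Suc (card V)"] by blast
  have "A = V"
  proof (rule ccontr)
    assume "A \<noteq> V"
    then obtain x where x: "x \<in> X" "(a x \<in> A) \<noteq> (b x \<in> A)"
      using crossing[of A] A by (auto simp: P_def)
    define v where "v = (if a x \<in> A then b x else a x)"
    have v: "v \<in> V" "v \<notin> A" using x ends[of x] by (auto simp: v_def)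
    have "finite A" using A \<open>finite V\<close> by (auto simp: P_def intro: finite_subset)
    have "insert x (inner A) \<subseteq> inner (insert v A)"
      using x by (auto simp: inner_def v_def)
    moreover have "x \<notin> inner A" using x by (auto simp: inner_def)
    moreover have "finite (inner B)" for B using \<open>finite X\<close> by (auto simp: inner_def)
    ultimately have "Suc (card (inner A)) \<le> card (inner (insert v A))"
      by (metis card_insert_disjoint card_mono)
    then have "P (insert v A)"
      using A v \<open>finite A\<close> by (auto simp: P_def)
    from max[OF this] show False using v \<open>finite A\<close> by simp
  qed
  moreover have "card (inner A) \<le> card X"
    using \<open>finite X\<close> by (auto simp: inner_def intro: card_mono)
  ultimately show ?thesis using A by (auto simp: P_def)
qed

lemma has_integral_of_bool_less:
  fixes x B :: real
  assumes "x \<le> B"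
  shows "((\<lambda>t. of_bool (t < x)) has_integral max 0 x) {0..B}"
proof -
  have "((\<lambda>t. 1 :: real) has_integral max 0 x) {0..max 0 x}"
    using has_integral_const_real[of "1::real" 0 "max 0 x"] by simp
  then have "((\<lambda>t. if t \<in> {0..max 0 x} then 1 else 0 :: real) has_integral max 0 x) {0..max B 0}"
    using assms by (subst has_integral_restrict) auto
  then have *: "((\<lambda>t. of_bool (t < x) :: real) has_integral max 0 x) {0..max B 0}"
    by (rule has_integral_spike[of "{0, x}", rotated 2]) auto
  show ?thesis
  proof (cases "0 \<le> B")
    case False
    then show ?thesis using assms by (simp add: max_def)
  qed (use * in \<open>simp add: max_def\<close>)
qed

text \<open>Layer-cake integration: the number of entries above \<open>t\<close> integrates to the
  sum of the positive parts. Entries of \<open>M\<close> may be negative; clipping them only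
  enlarges the left side.\<close>

lemma sum_mset_le_by_levels:
  fixes M N :: "real multiset"
  assumes levels: "\<And>t. 0 \<le> t \<Longrightarrow> size {#x \<in># M. t < x#} \<le> size {#x \<in># N. t < x#}"
    and nonneg: "\<And>x. x \<in># N \<Longrightarrow> 0 \<le> x"
  shows "sum_mset M \<le> sum_mset N"
proof -
  define B where "B = Max (insert 0 (set_mset (M + N)))"
  have B: "x \<le> B" if "x \<in># M + N" for x
    unfolding B_def using that by (intro Max_ge) auto
  have int: "((\<lambda>t. real (size {#x \<in># K. t < x#})) has_integral (\<Sum>x\<in>#K. max 0 x)) {0..B}"
    if "\<And>x. x \<in># K \<Longrightarrow> x \<le> B" for K
    using that
  proof (induction K)
    case (add x K)
    have "((\<lambda>t. of_bool (t < x) + real (size {#x \<in># K. t < x#})) has_integral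
        max 0 x + (\<Sum>x\<in>#K. max 0 x)) {0..B}"
      using add by (intro has_integral_add has_integral_of_bool_less) auto
    moreover have "(\<lambda>t. of_bool (t < x) + real (size {#x \<in># K. t < x#})) =
        (\<lambda>t. real (size {#x \<in># add_mset x K. t < x#}))"
      by auto
    ultimately show ?case by simp
  qed simp
  have "sum_mset M \<le> (\<Sum>x\<in>#M. max 0 x)"
    using sum_mset_mono[of M "\<lambda>x. x" "max 0"] by simp
  also have "\<dots> \<le> (\<Sum>x\<in>#N. max 0 x)"
    by (rule has_integral_le[OF int int]) (use B levels in auto)
  also have "\<dots> = sum_mset N"
    using nonneg by (induction N) auto
  finally show ?thesis .
qed

lemma size_filter_image_mset_set:
  "finite A \<Longrightarrow> size {#x \<in># image_mset g (mset_set A). P x#} = card {a \<in> A. P (g a)}"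
  by (simp add: filter_mset_image_mset filter_mset_mset_set)

text \<open>Choose a minimizer \<open>c\<close> of \<open>h c y0\<close>, then repeat on the rest
  with \<open>c\<close> as the new start. The shift by one keeps the start \<open>y0\<close>
  arbitrary.\<close>

lemma greedy_enumeration:
  fixes h :: "'v \<Rightarrow> 'v \<Rightarrow> 'w :: linorder"
  assumes "finite C"
  shows "\<exists>ys. ys 0 = y0 \<and> bij_betw (\<lambda>i. ys (Suc i)) {..<card C} C \<and>
    (\<forall>i j. i \<le> j \<longrightarrow> j < card C \<longrightarrow> h (ys (Suc i)) (ys i) \<le> h (ys (Suc j)) (ys i))"
  using assms
proof (induction "card C" arbitrary: C y0)
  case 0
  then show ?case by (intro exI[of _ "\<lambda>_. y0"]) (auto simp: bij_betw_def)
next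
  case (Suc n)
  then have "C \<noteq> {}" by auto
  then obtain c where c: "c \<in> C" "\<And>x. x \<in> C \<Longrightarrow> h c y0 \<le> h x y0"
    using ex_min_if_finite[of "(\<lambda>x. h x y0) ` C"] Suc.prems by (auto simp: not_less)
  have n: "n = card (C - {c})" using Suc c by simp
  obtain ys where ys: "ys 0 = c" "bij_betw (\<lambda>i. ys (Suc i)) {..<n} (C - {c})"
    "\<And>i j. i \<le> j \<Longrightarrow> j < n \<Longrightarrow> h (ys (Suc i)) (ys i) \<le> h (ys (Suc j)) (ys i)"
    using Suc.hyps(1)[OF n, of c] Suc.prems n by auto
  define zs where "zs i = (case i of 0 \<Rightarrow> y0 | Suc j \<Rightarrow> ys j)" for i
  have bij: "bij_betw ys {..<Suc n} C"
  proof -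
    have "bij_betw ys (Suc ` {..<n}) (C - {c})"
      using ys(2) by (auto simp: bij_betw_def inj_on_def image_image)
    then have "bij_betw ys (insert 0 (Suc ` {..<n})) (insert c (C - {c}))"
      using ys(1) by (auto simp: bij_betw_def)
    then show ?thesis using c by (simp add: lessThan_Suc_eq_insert_0 insert_absorb)
  qed
  have "h (zs (Suc i)) (zs i) \<le> h (zs (Suc j)) (zs i)" if ij: "i \<le> j" "j < Suc n" for i j
  proof (cases i)
    case 0
    have "ys j \<in> C" using bij ij by (auto simp: bij_betw_def)
    then show ?thesis using 0 c ys(1) by (simp add: zs_def)
  next
    case (Suc k)
    then obtain l where "j = Suc l" using ij Suc by (cases j) auto
    then show ?thesis using Suc ij ys(3)[of k l] by (simp add: zs_def)
  qed
  then show ?case using bij Suc(2) by (intro exI[of _ zs]) (auto simp: zs_def)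
qed

section \<open>Graphs with a height function\<close>

text \<open>Edges point downwards. The two edges of a cut node coincide as pairs when a loop is cut,
  so edges are counted through \<open>V - {r}\<close> and \<open>C\<close> rather than through this
  set.\<close>

definition descents :: "'v set \<Rightarrow> 'v \<Rightarrow> ('v \<Rightarrow> 'v) \<Rightarrow> 'v set \<Rightarrow> ('v \<Rightarrow> 'v) \<Rightarrow> ('v \<times> 'v) set" where
  "descents V r par C oth = {(v, par v) |v. v \<in> V - {r}} \<union> {(c, oth c) |c. c \<in> C}"

text \<open>
  The assumption \<open>diam\<close> says that \<open>D\<close> is an upper bound for distances, in dual form: \<open>\<Psi>\<close> is a
  1-Lipschitz function on the nodes, and the left-hand side is the value of its largest 1-Lipschitz
  extension to the edge \<open>(v, u)\<close> at the point of height \<open>\<phi>\<close>.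
\<close>

locale height_graph =
  fixes V :: "'v set" and r :: 'v and par :: "'v \<Rightarrow> 'v" and C :: "'v set" and oth :: "'v \<Rightarrow> 'v"
    and f :: "'v \<Rightarrow> real" and D :: real
  assumes finite_V: "finite V"
    and root: "r \<in> V" "f r = 0"
    and par: "v \<in> V \<Longrightarrow> v \<noteq> r \<Longrightarrow> par v \<in> V \<and> f (par v) < f v"
    and C_subset: "C \<subseteq> V - {r}"
    and oth: "c \<in> C \<Longrightarrow> oth c \<in> V \<and> f (oth c) \<le> f c"
    and D_nonneg: "0 \<le> D"
    and diam: "(\<And>v u. (v, u) \<in> descents V r par C oth \<Longrightarrow> \<bar>\<Psi> v - \<Psi> u\<bar> \<le> f v - f u) \<Longrightarrow>
      (v, u) \<in> descents V r par C oth \<Longrightarrow> f u \<le> \<phi> \<Longrightarrow> \<phi> \<le> f v \<Longrightarrow> y \<in> V \<Longrightarrow>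
      min (\<Psi> v + (f v - \<phi>)) (\<Psi> u + (\<phi> - f u)) \<le> \<Psi> y + D"
begin

abbreviation E where "E \<equiv> descents V r par C oth"

lemma E_D: "(v, u) \<in> E \<Longrightarrow> v \<in> V \<and> v \<noteq> r \<and> u \<in> V \<and> f u \<le> f v"
  using par oth C_subset by (force simp: descents_def)

lemma E_par: "v \<in> V \<Longrightarrow> v \<noteq> r \<Longrightarrow> (v, par v) \<in> E"
  by (auto simp: descents_def)

lemma E_oth: "c \<in> C \<Longrightarrow> (c, oth c) \<in> E"
  by (auto simp: descents_def)

lemma height_nonneg: "v \<in> V \<Longrightarrow> 0 \<le> f v"
proof -
  obtain u where u: "u \<in> V" "\<And>x. x \<in> V \<Longrightarrow> f u \<le> f x"
    using ex_min_if_finite[of "f ` V"] finite_V root by (auto simp: not_less)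
  then have "u = r" using par[of u] by force
  then show "v \<in> V \<Longrightarrow> 0 \<le> f v" using u root by auto
qed

lemma diam_vertex:
  assumes "\<And>v u. (v, u) \<in> E \<Longrightarrow> \<bar>\<Psi> v - \<Psi> u\<bar> \<le> f v - f u" "x \<in> V" "x \<noteq> r" "y \<in> V"
  shows "\<Psi> x \<le> \<Psi> y + D"
proof -
  have e: "(x, par x) \<in> E" using assms E_par by auto
  have "min (\<Psi> x + (f x - f x)) (\<Psi> (par x) + (f x - f (par x))) \<le> \<Psi> y + D"
    by (rule diam[OF assms(1)]) (use e E_D assms in auto)
  then show ?thesis using assms(1)[OF e] by linarith
qed

lemma height_le: "v \<in> V \<Longrightarrow> f v \<le> D"
  using diam_vertex[of f v r] D_nonneg root E_D by (cases "v = r") fastforce+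

section \<open>Superlevel sets and saddle heights\<close>

definition level :: "real \<Rightarrow> ('v \<times> 'v) set" where
  "level t = {(a, b). ((a, b) \<in> E \<or> (b, a) \<in> E) \<and> t \<le> f a \<and> t \<le> f b}"

text \<open>The height bounds on both ends matter for the empty path, which would otherwise link a
  node to itself at every level.\<close>

definition linked :: "real \<Rightarrow> 'v \<Rightarrow> 'v \<Rightarrow> bool" where
  "linked t u y \<longleftrightarrow> t \<le> f u \<and> t \<le> f y \<and> (u, y) \<in> (level t)\<^sup>*"

text \<open>The highest pass between \<open>u\<close> and \<open>y\<close>. Restricting to heights
  of nodes makes the set finite and loses nothing, as the lowest height on a path is taken at a
  node.\<close>

definition saddle :: "'v \<Rightarrow> 'v \<Rightarrow> real" where
  "saddle u y = Max {t \<in> f ` V. linked t u y}"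

lemma linked_mono: "linked t u y \<Longrightarrow> s \<le> t \<Longrightarrow> linked s u y"
proof -
  assume "linked t u y" "s \<le> t"
  moreover from this have "(level t)\<^sup>* \<subseteq> (level s)\<^sup>*"
    by (intro rtrancl_mono) (auto simp: level_def)
  ultimately show ?thesis by (auto simp: linked_def)
qed

lemma linked_root:
  assumes "v \<in> V"
  shows "(v, r) \<in> (level 0)\<^sup>* \<and> (r, v) \<in> (level 0)\<^sup>*"
  using assms
proof (induction "card {u \<in> V. f u < f v}" arbitrary: v rule: less_induct)
  case less
  show ?case
  proof (cases "v = r")
    case False
    have p: "par v \<in> V" "f (par v) < f v" using par less False by auto
    have "card {u \<in> V. f u < f (par v)} < card {u \<in> V. f u < f v}"
      using p finite_V by (intro psubset_card_mono) (auto simp: psubset_eq)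
    then have "(par v, r) \<in> (level 0)\<^sup>*" "(r, par v) \<in> (level 0)\<^sup>*" using less.hyps p by auto
    moreover have "(v, par v) \<in> level 0" "(par v, v) \<in> level 0"
      using E_par False less.prems p height_nonneg by (auto simp: level_def)
    ultimately show ?thesis by (meson converse_rtrancl_into_rtrancl rtrancl_into_rtrancl)
  qed simp
qed

lemma saddle_linked:
  assumes "u \<in> V" "y \<in> V"
  shows "linked (saddle u y) u y" "0 \<le> saddle u y" "saddle u y \<in> f ` V"
proof -
  have "linked 0 u y"
    using linked_root assms height_nonneg by (auto simp: linked_def intro: rtrancl_trans)
  then have zero: "0 \<in> {t \<in> f ` V. linked t u y}" using root by force
  have fin: "finite {t \<in> f ` V. linked t u y}" using finite_V by auto
  have "saddle u y \<in> {t \<in> f ` V. linked t u y}"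
    unfolding saddle_def using fin zero by (metis Max_in empty_iff)
  moreover have "0 \<le> saddle u y"
    unfolding saddle_def using fin zero by (rule Max_ge)
  ultimately show "linked (saddle u y) u y" "0 \<le> saddle u y" "saddle u y \<in> f ` V" by auto
qed

lemma saddle_ge: "t \<in> f ` V \<Longrightarrow> linked t u y \<Longrightarrow> t \<le> saddle u y"
  unfolding saddle_def using finite_V by (intro Max_ge) auto

lemma saddle_le:
  assumes "u \<in> V" "y \<in> V"
  shows "saddle u y \<le> f u" "saddle u y \<le> f y"
  using saddle_linked[OF assms] by (auto simp: linked_def)

lemma saddle_self: "y \<in> V \<Longrightarrow> saddle y y = f y"
  using saddle_le[of y y] saddle_ge[of "f y" y y] by (auto simp: linked_def intro: antisym)

text \<open>Up to height \<open>f u\<close> the edge itself may be used, so \<open>u\<close> and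
  \<open>v\<close> are linked to the same nodes.\<close>

lemma saddle_edge:
  assumes "(v, u) \<in> E" "y \<in> V"
  shows "saddle u y \<le> saddle v y" "min (f u) (saddle v y) \<le> saddle u y"
proof -
  note e = E_D[OF assms(1)]
  have step: "linked t v y \<longleftrightarrow> linked t u y" if "t \<le> f u" for t
    using that e assms by (auto simp: linked_def level_def intro: converse_rtrancl_into_rtrancl)
  have "linked (saddle u y) u y" "saddle u y \<in> f ` V" "saddle u y \<le> f u"
    using saddle_linked[of u y] saddle_le[of u y] assms e by auto
  then show "saddle u y \<le> saddle v y" using step by (intro saddle_ge) auto
  have "min (f u) (saddle v y) \<in> f ` V"
    using saddle_linked(3)[of v y] assms e by (auto simp: min_def)
  moreover have "linked (min (f u) (saddle v y)) v y"
    using saddle_linked(1)[of v y] assms e linked_mono by auto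
  ultimately show "min (f u) (saddle v y) \<le> saddle u y" using step by (intro saddle_ge) auto
qed

text \<open>A path from \<open>u\<close> to \<open>y\<close> has to descend to the height \<^term>\<open>saddle u y\<close>, whence
  \<^term>\<open>f u + f y - 2 * saddle u y\<close> is a lower bound for its length.\<close>

lemma saddle_lipschitz:
  assumes "(v, u) \<in> E" "y \<in> V"
  shows "\<bar>(f v - 2 * saddle v y) - (f u - 2 * saddle u y)\<bar> \<le> f v - f u"
  using saddle_edge[OF assms] saddle_le[of v y] saddle_le[of u y] E_D[OF assms(1)] assms by auto

lemma saddle_diam:
  assumes "u \<in> V" "y \<in> V"
  shows "f u + f y - 2 * saddle u y \<le> D"
proof (cases "u = r")
  case True
  then show ?thesis using root assms saddle_linked(2)[of u y] height_le[of y] by auto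
next
  case False
  show ?thesis
    using diam_vertex[of "\<lambda>v. f v - 2 * saddle v y" u y] saddle_lipschitz assms False saddle_self
    by auto
qed

section \<open>Pieces of superlevel sets\<close>

lemma saddle_closed:
  assumes "u \<in> V" "y \<in> V" "t < saddle u y"
    and closed: "\<And>a b. (a, b) \<in> E \<Longrightarrow> t < f b \<Longrightarrow> a \<in> R \<longleftrightarrow> b \<in> R"
  shows "u \<in> R \<longleftrightarrow> y \<in> R"
proof -
  have "(u, y) \<in> (level (saddle u y))\<^sup>*" using saddle_linked assms by (auto simp: linked_def)
  then show ?thesis
    by (induction rule: rtrancl_induct) (use assms in \<open>force simp: level_def\<close>)+
qed

text \<open>A path from \<open>y\<close> enters the piece \<open>R\<close> either from height at
  most \<open>t\<close> or through the second edge of a cut node \<open>c\<close> with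
  \<open>f c - saddle c y\<close> at least \<open>a\<close>. Both ways are long enough to put a
  point at height \<open>a + t\<close> at distance at least \<open>f y + a - t\<close> from
  \<open>y\<close>.\<close>

lemma barrier:
  assumes "0 \<le> t" "y \<in> V" "y \<notin> R" and R: "\<And>v. v \<in> R \<Longrightarrow> v \<in> V \<and> t < f v"
    and closed: "\<And>v. v \<in> V \<Longrightarrow> v \<noteq> r \<Longrightarrow> t < f (par v) \<Longrightarrow> v \<in> R \<longleftrightarrow> par v \<in> R"
    and crossing: "\<And>c. c \<in> C \<Longrightarrow> t < f (oth c) \<Longrightarrow> (c \<in> R) \<noteq> (oth c \<in> R) \<Longrightarrow> a \<le> f c - saddle c y"
    and "0 \<le> a"
    and location: "(\<exists>v\<in>R. a + t \<le> f v) \<or>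
      (\<exists>c\<in>C - R. a \<le> f c - saddle c y \<and> a + t \<le> f c \<and> (oth c \<in> R \<or> f (oth c) \<le> t))"
  shows "f y + a - t \<le> D"
proof -
  define W where "W z = f z - 2 * saddle z y" for z
  \<comment> \<open>\<open>f y + I z\<close> bounds the length of a path from \<open>y\<close> into
    \<open>R\<close> ending at \<open>z\<close>: at least \<open>f y + f z - 2 * t\<close> after a
    descent to height \<open>t\<close>, and at least \<open>f y + 2 * a - f z\<close> after passing
    a cut node. The two agree at height \<open>a + t\<close>.\<close>
  define I where "I z = min (f z - 2 * t) (2 * a - f z)" for z
  define \<Psi> where "\<Psi> z = (if z \<in> R then max (W z) (I z) else W z)" for z
  have W: "\<bar>W v - W u\<bar> \<le> f v - f u" if "(v, u) \<in> E" for v u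
    using saddle_lipschitz[OF that \<open>y \<in> V\<close>] by (simp add: W_def)
  have W_ge: "- f z \<le> W z" if "z \<in> V" for z
    using saddle_le[OF that \<open>y \<in> V\<close>] by (simp add: W_def)
  have low: "I v - W u \<le> f v - f u" if "(v, u) \<in> E" "f u \<le> t" for v u
    using W_ge[of u] E_D[OF that(1)] that(2) by (auto simp: I_def)
  have up: "I v - W u \<le> f v - f u" if "(v, u) \<in> E" "a \<le> f v - saddle v y" for v u
    using saddle_edge[OF that(1) \<open>y \<in> V\<close>] that(2) by (auto simp: I_def W_def)
  have down: "I u - W v \<le> f v - f u" if "(v, u) \<in> E" "a \<le> f v - saddle v y" for v u
    using that(2) by (auto simp: I_def W_def)
  have inner: "\<bar>I v - I u\<bar> \<le> f v - f u" if "(v, u) \<in> E" for v u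
    using E_D[OF that] by (auto simp: I_def)
  have lip: "\<bar>\<Psi> v - \<Psi> u\<bar> \<le> f v - f u" if e: "(v, u) \<in> E" for v u
  proof -
    consider "v \<in> R \<longleftrightarrow> u \<in> R" | "(v \<in> R) \<noteq> (u \<in> R)" "f u \<le> t"
      | "(v \<in> R) \<noteq> (u \<in> R)" "t < f u" "a \<le> f v - saddle v y"
    proof (cases "t < f u \<and> (v \<in> R) \<noteq> (u \<in> R)")
      case True
      \<comment> \<open>Tree edges above \<open>t\<close> do not leave \<open>R\<close>, so only the
        second edge of a cut node can cross here.\<close>
      then have "v \<in> C \<and> u = oth v"
        using e closed[of v] by (auto simp: descents_def)
      then show ?thesis using that(3) True crossing[of v] by blast
    qed (use that in fastforce)
    then show ?thesis
    proof cases
      case 1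
      then show ?thesis using W[OF e] inner[OF e] by (auto simp: \<Psi>_def)
    next
      case 2
      then have "v \<in> R" "u \<notin> R" using R by force+
      then show ?thesis using W[OF e] low[OF e 2(2)] by (auto simp: \<Psi>_def)
    next
      case 3
      then show ?thesis using W[OF e] up[OF e 3(3)] down[OF e 3(3)] by (auto simp: \<Psi>_def)
    qed
  qed
  have "\<Psi> y = - f y" using assms saddle_self by (simp add: \<Psi>_def W_def)
  \<comment> \<open>An edge through height \<open>a + t\<close> on which the extension of
    \<open>\<Psi>\<close> is at least \<open>a - t\<close> at that height.\<close>
  moreover obtain v u where e: "(v, u) \<in> E" "f u \<le> a + t" "a + t \<le> f v"
    and v: "2 * a - f v \<le> \<Psi> v" and u: "f u - 2 * t \<le> \<Psi> u"
  proof -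
    have u_le: "f u - 2 * t \<le> \<Psi> u" if "u \<in> V" "f u \<le> a + t" "u \<in> R \<or> f u \<le> t" for u
      using that W_ge[of u] by (auto simp: \<Psi>_def I_def)
    show thesis
    proof (cases "\<exists>v\<in>R. a + t \<le> f v")
      case True
      have "finite {v \<in> R. a + t \<le> f v}"
        using finite_V by (rule finite_subset[rotated]) (use R in auto)
      \<comment> \<open>By minimality of \<open>f v\<close>, the parent edge of \<open>v\<close>
        reaches down to height \<open>a + t\<close>.\<close>
      then obtain v where v: "v \<in> R" "a + t \<le> f v" "\<And>u. u \<in> R \<Longrightarrow> a + t \<le> f u \<Longrightarrow> f v \<le> f u"
        using ex_min_if_finite[of "f ` {v \<in> R. a + t \<le> f v}"] True by (auto simp: not_less)
      have "v \<noteq> r" "v \<in> V" using R[OF v(1)] root \<open>0 \<le> t\<close> by auto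
      then have p: "par v \<in> V" "f (par v) < f v" "par v \<in> R \<or> f (par v) \<le> t"
        using par closed[of v] v by auto
      have "f (par v) \<le> a + t" using v(3)[of "par v"] p \<open>0 \<le> a\<close> by linarith
      then show thesis
        using that[of v "par v"] E_par[OF \<open>v \<in> V\<close> \<open>v \<noteq> r\<close>] u_le[of "par v"] p v
        by (auto simp: \<Psi>_def I_def)
    next
      case False
      then obtain c where c: "c \<in> C" "c \<notin> R" "a \<le> f c - saddle c y" "a + t \<le> f c"
        "oth c \<in> R \<or> f (oth c) \<le> t"
        using location by blast
      have "f (oth c) \<le> a + t" using False c(5) \<open>0 \<le> a\<close> by (meson add_increasing le_less_linear less_imp_le order_trans)
      then show thesis
        using that[of c "oth c"] E_oth[of c] c oth[of c] u_le[of "oth c"]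
        by (auto simp: \<Psi>_def W_def)
    qed
  qed
  have "min (\<Psi> v + (f v - (a + t))) (\<Psi> u + ((a + t) - f u)) \<le> \<Psi> y + D"
    by (rule diam[OF lip]) (use e \<open>y \<in> V\<close> in auto)
  ultimately show ?thesis using v u by linarith
qed

text \<open>A highest node of \<open>R\<close> outside \<open>C\<close> and \<open>L\<close> is the
  lower end of an edge whose upper end, again in \<open>R\<close>, has the same height; only second
  edges of nodes in \<open>C\<close> can be level.\<close>

lemma top_exists:
  assumes "R \<noteq> {}" "0 \<le> t" and R: "\<And>v. v \<in> R \<Longrightarrow> v \<in> V \<and> t < f v"
    and closed: "\<And>a b. (a, b) \<in> E \<Longrightarrow> t < f b \<Longrightarrow> a \<in> R \<longleftrightarrow> b \<in> R"
    and tops: "\<And>v. v \<in> V - {r} - C - L \<Longrightarrow> \<exists>u. (u, v) \<in> E"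
  shows "R \<inter> (C \<union> L) \<noteq> {}"
proof (rule ccontr)
  assume *: "\<not> ?thesis"
  have "finite R" using finite_V by (rule finite_subset[rotated]) (use R in auto)
  then obtain v where v: "v \<in> R" "\<And>u. u \<in> R \<Longrightarrow> f u \<le> f v"
    using \<open>R \<noteq> {}\<close> Max_in[of "f ` R"] Max_ge[of "f ` R"] by (metis (no_types, lifting) empty_is_image
      finite_imageI image_eqI image_iff)
  have "v \<in> V - {r} - C - L" using v * R[of v] root \<open>0 \<le> t\<close> by auto
  then obtain u where u: "(u, v) \<in> E" using tops by blast
  then have "u \<in> R" using closed v R[of v] by blast
  then have "f u \<le> f v" "u \<notin> C" using v * by auto
  then show False using u par[of u] by (auto simp: descents_def)
qed

text \<open>After removal of the second edges of all peaks with \<open>t < \<delta> i\<close>, the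
  seeds \<open>S\<close> still meet every component of the superlevel set. Counting vertices against
  the remaining edges gives the bound.\<close>

lemma level_count:
  fixes ys :: "nat \<Rightarrow> 'v" and L :: "'v set" and t :: real
  defines "m \<equiv> \<lambda>i. saddle (ys (Suc i)) (ys i)"
  defines "\<delta> \<equiv> \<lambda>i. f (ys i) + f (ys (Suc i)) - m i - D"
  assumes "0 \<le> t" "ys 0 \<in> V" "L \<subseteq> V - {r}"
    and tops: "\<And>v. v \<in> V - {r} - C - L \<Longrightarrow> \<exists>u. (u, v) \<in> E"
    and bij: "bij_betw (\<lambda>i. ys (Suc i)) {..<card C} C"
    and greedy: "\<And>i j. i \<le> j \<Longrightarrow> j < card C \<Longrightarrow>
      f (ys (Suc i)) - saddle (ys (Suc i)) (ys i) \<le> f (ys (Suc j)) - saddle (ys (Suc j)) (ys i)"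
  shows "card {v \<in> V. t < f v} + card {i \<in> {..<card C}. t < \<delta> i}
    \<le> card {v \<in> V - {r}. t < f (par v)} + card {c \<in> C. t < f (oth c)}
      + (card {i \<in> {..<card C}. m i \<le> t \<and> t < f (ys (Suc i))} + card {x \<in> {ys 0}. t < f x}
      + card {l \<in> L - {ys 0}. saddle l (ys 0) \<le> t \<and> t < f l})"
proof -
  define n where "n = card C"
  define I where "I = {i. i < n \<and> t < \<delta> i}"
  define X where "X = (\<lambda>i. ys (Suc i)) ` I"
  define Vt where "Vt = {v \<in> V. t < f v}"
  have finite_C: "finite C" using finite_V C_subset by (meson finite_Diff finite_subset)
  have ys_C: "ys (Suc i) \<in> C" if "i < n" for i
    using bij that by (auto simp: bij_betw_def n_def)
  have ys_V: "ys i \<in> V" if "i \<le> n" for i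
    using that ys_C[of "i - 1"] C_subset assms by (cases i) auto
  have C_ys: "\<exists>i<n. c = ys (Suc i)" if "c \<in> C" for c
    using bij that by (auto simp: bij_betw_def n_def)
  have X_C: "X \<subseteq> C" using ys_C by (auto simp: X_def I_def)
  have card_X: "card X = card I"
    unfolding X_def using bij by (intro card_image) (auto simp: bij_betw_def I_def n_def inj_on_def)
  \<comment> \<open>\<open>saddle_diam\<close> says that
    \<open>\<delta> i \<le> m i\<close>.\<close>
  have m_gt: "t < m i" if "i \<in> I" for i
    using that saddle_diam[of "ys (Suc i)" "ys i"] ys_V[of i] ys_V[of "Suc i"]
    by (auto simp: I_def \<delta>_def m_def)
  \<comment> \<open>\<open>barrier\<close> with \<open>a = f (ys (Suc i)) - m i\<close> would give
    \<open>\<delta> i \<le> t\<close>.\<close>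
  have no_barrier: False
    if i: "i \<in> I" and "ys i \<notin> R" and R: "\<And>v. v \<in> R \<Longrightarrow> v \<in> V \<and> t < f v"
      and closed: "\<And>v. v \<in> V \<Longrightarrow> v \<noteq> r \<Longrightarrow> t < f (par v) \<Longrightarrow> v \<in> R \<longleftrightarrow> par v \<in> R"
      and crossing: "\<And>c. c \<in> C \<Longrightarrow> t < f (oth c) \<Longrightarrow> (c \<in> R) \<noteq> (oth c \<in> R) \<Longrightarrow>
        f (ys (Suc i)) - m i \<le> f c - saddle c (ys i)"
      and loc: "ys (Suc i) \<in> R \<or> oth (ys (Suc i)) \<in> R \<or> f (oth (ys (Suc i))) \<le> t" for i R
  proof -
    have n: "i < n" "ys i \<in> V" "ys (Suc i) \<in> V" "ys (Suc i) \<in> C"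
      using i ys_V[of i] ys_V[of "Suc i"] ys_C[of i] by (auto simp: I_def)
    have "m i \<le> f (ys (Suc i))" unfolding m_def using n by (intro saddle_le)
    moreover define a where "a = f (ys (Suc i)) - m i"
    ultimately have a: "0 \<le> a" "a + t \<le> f (ys (Suc i))" "a \<le> f (ys (Suc i)) - saddle (ys (Suc i)) (ys i)"
      using m_gt[OF i] by (auto simp: m_def)
    have "(\<exists>v\<in>R. a + t \<le> f v) \<or> (\<exists>c\<in>C - R. a \<le> f c - saddle c (ys i) \<and> a + t \<le> f c \<and>
        (oth c \<in> R \<or> f (oth c) \<le> t))"
      using loc n a by (cases "ys (Suc i) \<in> R") blast+
    then have "f (ys i) + a - t \<le> D"
      using barrier[OF \<open>0 \<le> t\<close> n(2) \<open>ys i \<notin> R\<close> R closed, of a] crossing a by (simp add: a_def)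
    then show False using i by (auto simp: I_def \<delta>_def a_def)
  qed
  have X_oth: "X \<subseteq> {c \<in> C. t < f (oth c)}"
  proof -
    \<comment> \<open>Even the empty piece is a barrier if the second edge reaches down to
      \<open>t\<close>. Hence every removed edge had been counted.\<close>
    have "t < f (oth (ys (Suc i)))" if "i \<in> I" for i
      using no_barrier[of i "{}"] that by force
    then show ?thesis using X_C by (auto simp: X_def)
  qed
  define S where "S = (\<lambda>i. ys (Suc i)) ` {i \<in> {..<n}. m i \<le> t \<and> t < f (ys (Suc i))}
    \<union> {x \<in> {ys 0}. t < f x} \<union> {l \<in> L - {ys 0}. saddle l (ys 0) \<le> t \<and> t < f l}"
  have S_Vt: "S \<subseteq> Vt"
    using ys_V[of 0] ys_V[of "Suc _"] assms by (auto simp: S_def Vt_def Suc_le_eq)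
  define XP where "XP = {v \<in> V - {r}. t < f (par v)}"
  define XC where "XC = {c \<in> C. t < f (oth c)} - X"
  \<comment> \<open>\<open>Inl\<close> marks parent edges and \<open>Inr\<close> second edges, each
    named by its upper end.\<close>
  have "card Vt \<le> card S + card (Inl ` XP \<union> Inr ` XC)"
  proof (rule card_le_card_plus_card_edges[where a = "case_sum id id" and b = "case_sum par oth"])
    show "finite Vt" "finite (Inl ` XP \<union> Inr ` XC)" "S \<subseteq> Vt"
      using finite_V finite_C S_Vt by (auto simp: Vt_def XP_def XC_def)
    show "case_sum id id x \<in> Vt \<and> case_sum par oth x \<in> Vt" if "x \<in> Inl ` XP \<union> Inr ` XC" for x
      using that par oth C_subset by (auto simp: XP_def XC_def Vt_def intro: less_trans less_le_trans)
    fix A assume A: "S \<subseteq> A" "A \<subset> Vt"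
    show "\<exists>x \<in> Inl ` XP \<union> Inr ` XC. (case_sum id id x \<in> A) \<noteq> (case_sum par oth x \<in> A)"
    proof (rule ccontr)
      assume none: "\<not> ?thesis"
      define R where "R = Vt - A"
      have R: "R \<noteq> {}" "R \<subseteq> Vt" "R \<inter> S = {}" using A by (auto simp: R_def)
      have par_closed: "v \<in> R \<longleftrightarrow> par v \<in> R" if "v \<in> V" "v \<noteq> r" "t < f (par v)" for v
      proof -
        have "v \<in> XP" using that by (auto simp: XP_def)
        then have "v \<in> A \<longleftrightarrow> par v \<in> A" using none by force
        then show ?thesis using that par[of v] by (auto simp: R_def Vt_def)
      qed
      have oth_Vt: "c \<in> Vt \<and> oth c \<in> Vt" if "c \<in> C" "t < f (oth c)" for c
        using that oth[of c] C_subset by (auto simp: Vt_def)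
      have oth_closed: "c \<in> R \<longleftrightarrow> oth c \<in> R" if "c \<in> C" "t < f (oth c)" "c \<notin> X" for c
      proof -
        have "c \<in> XC" using that by (auto simp: XC_def)
        then have "c \<in> A \<longleftrightarrow> oth c \<in> A" using none by force
        then show ?thesis using oth_Vt[of c] that by (auto simp: R_def)
      qed
      define B where "B = {i \<in> I. (ys (Suc i) \<in> R) \<noteq> (oth (ys (Suc i)) \<in> R)}"
      show False
      proof (cases "B = {}")
        case False
        \<comment> \<open>With the least index, \<open>greedy\<close> covers every crossing
          edge.\<close>
        define i where "i = (LEAST i. i \<in> B)"
        have i: "i \<in> B" "\<And>j. j \<in> B \<Longrightarrow> i \<le> j"
          using False unfolding i_def by (auto intro: LeastI Least_le)
        \<comment> \<open>The side that avoids \<open>ys i\<close>; it has the same crossing edges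
          above \<open>t\<close>.\<close>
        define Q where "Q = (if ys i \<in> R then Vt - R else R)"
        have iff: "(c \<in> Q) = (d \<in> Q) \<longleftrightarrow> (c \<in> R) = (d \<in> R)" if "c \<in> Vt" "d \<in> Vt" for c d
          using that by (auto simp: Q_def)
        have iX: "ys (Suc i) \<in> C" "t < f (oth (ys (Suc i)))"
          using i(1) X_oth by (auto simp: B_def X_def)
        show False
        proof (rule no_barrier[of i Q])
          show "i \<in> I" using i by (auto simp: B_def)
          show "ys i \<notin> Q" by (auto simp: Q_def)
          show "v \<in> V \<and> t < f v" if "v \<in> Q" for v
            using that R by (auto simp: Q_def Vt_def split: if_splits)
          show "v \<in> Q \<longleftrightarrow> par v \<in> Q" if "v \<in> V" "v \<noteq> r" "t < f (par v)" for v
            using par_closed[OF that] iff[of v "par v"] par[of v] that by (auto simp: Vt_def)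
          show "f (ys (Suc i)) - m i \<le> f c - saddle c (ys i)"
            if c: "c \<in> C" "t < f (oth c)" "(c \<in> Q) \<noteq> (oth c \<in> Q)" for c
          proof -
            have "(c \<in> R) \<noteq> (oth c \<in> R)" using c iff[of c "oth c"] oth_Vt[of c] by auto
            then obtain j where "c = ys (Suc j)" "j \<in> I" "j \<in> B"
              using oth_closed[of c] c by (auto simp: X_def B_def)
            then show ?thesis using greedy[of i j] i(2)[of j] by (auto simp: m_def I_def n_def)
          qed
          have "(ys (Suc i) \<in> Q) \<noteq> (oth (ys (Suc i)) \<in> Q)"
            using i(1) iff[of "ys (Suc i)" "oth (ys (Suc i))"] oth_Vt[OF iX] by (auto simp: B_def)
          then show "ys (Suc i) \<in> Q \<or> oth (ys (Suc i)) \<in> Q \<or> f (oth (ys (Suc i))) \<le> t" by blast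
        qed
      next
        case True
        have closed: "a \<in> R \<longleftrightarrow> b \<in> R" if e: "(a, b) \<in> E" and "t < f b" for a b
        proof -
          from e consider "a \<in> V" "a \<noteq> r" "b = par a" | "a \<in> C" "b = oth a"
            by (auto simp: descents_def)
          then show ?thesis
          proof cases
            case 2
            then show ?thesis using oth_closed[of a] that True by (auto simp: X_def B_def)
          qed (use par_closed that in auto)
        qed
        have base: "ys 0 \<notin> R" using R by (auto simp: S_def Vt_def)
        \<comment> \<open>A peak \<open>ys (Suc j)\<close> in \<open>R\<close> is no seed, so
          \<open>t < m j\<close> and it shares a component with \<open>ys j\<close>; starting from
          \<open>ys 0\<close>, all peaks are excluded in turn.\<close>
        have "ys j \<notin> R" if "j \<le> n" for j
          using that
        proof (induction j)
          case (Suc j)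
          show ?case
          proof
            assume "ys (Suc j) \<in> R"
            then have "t < m j" using R Suc.prems by (force simp: S_def Vt_def)
            then have "ys (Suc j) \<in> R \<longleftrightarrow> ys j \<in> R"
              using saddle_closed[OF ys_V ys_V, of "Suc j" j t R] closed Suc.prems by (simp add: m_def)
            then show False using Suc \<open>ys (Suc j) \<in> R\<close> by auto
          qed
        qed (rule base)
        then have "R \<inter> C = {}" using C_ys by fastforce
        moreover have "l \<notin> R" if "l \<in> L" for l
        proof
          assume "l \<in> R"
          then have "l \<noteq> ys 0" using base by auto
          then have "t < saddle l (ys 0)" using R that \<open>l \<in> R\<close> by (force simp: S_def Vt_def)
          then have "l \<in> R \<longleftrightarrow> ys 0 \<in> R"
            using saddle_closed[of l "ys 0" t R] closed that assms by blast
          then show False using base \<open>l \<in> R\<close> by auto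
        qed
        moreover have "R \<inter> (C \<union> L) \<noteq> {}"
          using R(1) \<open>0 \<le> t\<close> _ closed tops by (rule top_exists) (use R in \<open>auto simp: Vt_def\<close>)
        ultimately show False by blast
      qed
    qed
  qed
  moreover have "card (Inl ` XP \<union> Inr ` XC) = card XP + card XC"
    using finite_V finite_C
    by (subst card_Un_disjoint) (auto simp: XP_def XC_def card_image inj_on_def)
  moreover have "card XC = card {c \<in> C. t < f (oth c)} - card I" "card I \<le> card {c \<in> C. t < f (oth c)}"
    using X_oth finite_C card_X card_mono[OF _ X_oth] finite_subset[OF X_C]
    by (auto simp: XC_def card_Diff_subset)
  moreover have "card S \<le> card {i \<in> {..<n}. m i \<le> t \<and> t < f (ys (Suc i))} + card {x \<in> {ys 0}. t < f x}
      + card {l \<in> L - {ys 0}. saddle l (ys 0) \<le> t \<and> t < f l}"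
    unfolding S_def by (intro order_trans[OF card_Un_le] add_mono card_image_le order_refl) auto
  moreover have "{i \<in> {..<n}. t < \<delta> i} = I" by (auto simp: I_def)
  ultimately show ?thesis by (simp add: Vt_def XP_def n_def)
qed

text \<open>This is \<open>level_count\<close> integrated over \<open>t\<close>. After telescoping,
  one term \<open>f (ys n)\<close> remains, and each element of \<open>L\<close> other than
  \<open>y0\<close> costs at most \<open>D / 2\<close>.\<close>

lemma total_descent_le:
  fixes L :: "'v set"
  assumes "L \<subseteq> V - {r}" and tops: "\<And>v. v \<in> V - {r} - C - L \<Longrightarrow> \<exists>u. (u, v) \<in> E"
  shows "(\<Sum>v\<in>V - {r}. f v - f (par v)) + (\<Sum>c\<in>C. f c - f (oth c))
    \<le> (real (card C) + max 1 ((real (card L) + 1) / 2)) * D"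
proof -
  define n where "n = card C"
  have finite_C: "finite C" using finite_V C_subset by (meson finite_Diff finite_subset)
  have finite_L: "finite L" using finite_V assms by (meson finite_Diff finite_subset)
  obtain y0 where y0: "y0 \<in> V" "\<And>l. l \<in> L \<Longrightarrow> y0 \<in> L \<and> f l \<le> f y0"
  proof (cases "L = {}")
    case False
    then obtain y where "y \<in> L" "\<And>l. l \<in> L \<Longrightarrow> f l \<le> f y"
      using finite_L Max_in[of "f ` L"] Max_ge[of "f ` L"] by (metis (no_types, lifting) empty_is_image
        finite_imageI image_eqI image_iff)
    then show thesis using that assms by blast
  qed (use that root in auto)
  obtain ys where ys: "ys 0 = y0" "bij_betw (\<lambda>i. ys (Suc i)) {..<n} C"
    "\<And>i j. i \<le> j \<Longrightarrow> j < n \<Longrightarrow>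
      f (ys (Suc i)) - saddle (ys (Suc i)) (ys i) \<le> f (ys (Suc j)) - saddle (ys (Suc j)) (ys i)"
    using greedy_enumeration[OF finite_C, of y0 "\<lambda>c y. f c - saddle c y"] unfolding n_def by blast
  have ys_V: "ys i \<in> V" if "i \<le> n" for i
  proof (cases i)
    case (Suc j)
    then have "ys i \<in> C" using ys(2) that by (auto simp: bij_betw_def)
    then show ?thesis using C_subset by auto
  qed (use ys y0 in auto)
  define m where "m i = saddle (ys (Suc i)) (ys i)" for i
  define \<delta> where "\<delta> i = f (ys i) + f (ys (Suc i)) - m i - D" for i
  define K where "K = L - {y0}"
  \<comment> \<open>Adding the \<open>m i\<close> and the saddles to both sides completes the
    restricted counts of \<open>level_count\<close> to those of \<open>f (ys (Suc i))\<close> and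
    \<open>f l\<close>.\<close>
  define M where "M = image_mset f (mset_set V) + image_mset \<delta> (mset_set {..<n})
    + image_mset m (mset_set {..<n}) + image_mset (\<lambda>l. saddle l y0) (mset_set K)"
  define N where "N = image_mset (\<lambda>v. f (par v)) (mset_set (V - {r})) + image_mset (\<lambda>c. f (oth c)) (mset_set C)
    + image_mset (\<lambda>i. f (ys (Suc i))) (mset_set {..<n}) + image_mset f (mset_set {y0})
    + image_mset f (mset_set K)"
  have "sum_mset M \<le> sum_mset N"
  proof (rule sum_mset_le_by_levels)
    show "0 \<le> x" if "x \<in># N" for x
      using that par oth ys_V y0 finite_V finite_C finite_L assms
      by (auto simp: N_def K_def intro!: height_nonneg)
    fix t :: real assume t: "0 \<le> t"
    have 1: "card {i \<in> {..<n}. t < f (ys (Suc i))} =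
        card {i \<in> {..<n}. t < m i} + card {i \<in> {..<n}. m i \<le> t \<and> t < f (ys (Suc i))}"
    proof -
      have "m i \<le> f (ys (Suc i))" if "i < n" for i
        unfolding m_def using ys_V that by (intro saddle_le) auto
      then have "{i \<in> {..<n}. t < f (ys (Suc i))} =
          {i \<in> {..<n}. t < m i} \<union> {i \<in> {..<n}. m i \<le> t \<and> t < f (ys (Suc i))}"
        by force
      then show ?thesis by (simp add: card_Un_disjoint disjoint_iff)
    qed
    have 2: "card {l \<in> K. t < f l} =
        card {l \<in> K. t < saddle l y0} + card {l \<in> K. saddle l y0 \<le> t \<and> t < f l}"
    proof -
      have "saddle l y0 \<le> f l" if "l \<in> K" for l
        using that y0 assms by (intro saddle_le) (auto simp: K_def)
      then have "{l \<in> K. t < f l} = {l \<in> K. t < saddle l y0} \<union> {l \<in> K. saddle l y0 \<le> t \<and> t < f l}"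
        by force
      then show ?thesis using finite_L by (simp add: card_Un_disjoint disjoint_iff K_def)
    qed
    have "card {v \<in> V. t < f v} + card {i \<in> {..<n}. t < \<delta> i}
      \<le> card {v \<in> V - {r}. t < f (par v)} + card {c \<in> C. t < f (oth c)}
        + (card {i \<in> {..<n}. m i \<le> t \<and> t < f (ys (Suc i))} + card {x \<in> {y0}. t < f x}
        + card {l \<in> K. saddle l y0 \<le> t \<and> t < f l})"
      using level_count[OF t _ assms, of ys] ys y0 unfolding n_def m_def \<delta>_def K_def by simp
    then show "size {#x \<in># M. t < x#} \<le> size {#x \<in># N. t < x#}"
      using 1 2 finite_V finite_C finite_L
      unfolding M_def N_def filter_union_mset size_union
      by (subst (1 2 3 4 5 6 7 8 9) size_filter_image_mset_set) (auto simp: K_def)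
  qed
  then have "sum f V + (\<Sum>i<n. \<delta> i) + (\<Sum>i<n. m i) + (\<Sum>l\<in>K. saddle l y0)
      \<le> (\<Sum>v\<in>V - {r}. f (par v)) + (\<Sum>c\<in>C. f (oth c)) + (\<Sum>i<n. f (ys (Suc i))) + f y0 + sum f K"
    by (simp add: M_def N_def sum_unfold_sum_mset)
  moreover have "(\<Sum>i<n. \<delta> i) + (\<Sum>i<n. m i) =
      f y0 - f (ys n) + 2 * (\<Sum>i<n. f (ys (Suc i))) - n * D"
  proof -
    have "(\<Sum>i<n. f (ys i)) = f y0 - f (ys n) + (\<Sum>i<n. f (ys (Suc i)))"
      using sum_lessThan_telescope[of "\<lambda>i. f (ys i)" n] ys(1) by (simp add: sum_subtractf)
    then show ?thesis by (simp add: \<delta>_def sum.distrib sum_subtractf)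
  qed
  moreover have "(\<Sum>i<n. f (ys (Suc i))) = sum f C"
    using ys(2) by (rule sum.reindex_bij_betw)
  moreover have "sum f V = sum f (V - {r})"
    using root finite_V by (simp add: sum.remove)
  ultimately have *: "(\<Sum>v\<in>V - {r}. f v - f (par v)) + (\<Sum>c\<in>C. f c - f (oth c))
      \<le> n * D + f (ys n) + (\<Sum>l\<in>K. f l - saddle l y0)"
    by (simp add: sum_subtractf)
  have "f (ys n) \<le> D" using ys_V height_le by auto
  moreover have "(\<Sum>l\<in>K. f l - saddle l y0) \<le> (\<Sum>l\<in>K. D / 2)"
  proof (rule sum_mono)
    fix l assume "l \<in> K"
    then have "l \<in> V" "f l \<le> f y0" using y0 assms by (auto simp: K_def)
    then show "f l - saddle l y0 \<le> D / 2" using saddle_diam[of l y0] y0 by linarith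
  qed
  moreover have "1 + real (card K) / 2 \<le> max 1 ((real (card L) + 1) / 2)"
  proof (cases "L = {}")
    case False
    then have "y0 \<in> L" using y0 by blast
    then have "card L = Suc (card K)"
      unfolding K_def using finite_L by (intro card.remove)
    then show ?thesis by simp
  qed (simp add: K_def)
  then have "(1 + real (card K) / 2) * D \<le> max 1 ((real (card L) + 1) / 2) * D"
    using D_nonneg by (rule mult_right_mono)
  ultimately show ?thesis using * by (simp add: n_def algebra_simps)
qed

end

section \<open>Distance from a root in a metric graph\<close>

context metric_graph
begin

text \<open>Duality: a function that is 1-Lipschitz along every arc bounds distances from
  below.\<close>

lemma gdist_ge_potential:
  fixes \<Psi> :: "'a \<Rightarrow> real" and \<Phi> :: "'b \<Rightarrow> real \<Rightarrow> real"
  assumes lip: "\<And>e s t. e \<in> arcs G \<Longrightarrow> s \<in> {0..w e} \<Longrightarrow> t \<in> {0..w e} \<Longrightarrow> \<Phi> e t - \<Phi> e s \<le> \<bar>t - s\<bar>"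
    and ends: "\<And>e. e \<in> arcs G \<Longrightarrow> \<Phi> e 0 = \<Psi> (tail G e) \<and> \<Phi> e (w e) = \<Psi> (head G e)"
    and "x \<in> gpoints G w" "y \<in> gpoints G w"
  shows "case_gpoint \<Psi> \<Phi> y - case_gpoint \<Psi> \<Phi> x \<le> gdist G w x y"
proof (rule gdist_greatest[OF assms(3,4)])
  have "case_gpoint \<Psi> \<Phi> (edge_point G w e t) = \<Phi> e t" if "e \<in> arcs G" for e t
    using ends[OF that] by (auto simp: edge_point_def)
  then show "case_gpoint \<Psi> \<Phi> y - case_gpoint \<Psi> \<Phi> x \<le> gpath_length p" if "gpath G w x p y" for p
    using gpath_lipschitz[OF _ that, of "case_gpoint \<Psi> \<Phi>"] lip by simp
qed

lemma gdist_arc_le: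
  assumes "e \<in> arcs G"
  shows "gdist G w (Vertex (tail G e)) (Vertex (head G e)) \<le> w e"
proof -
  have "0 < w e" using assms edge_pos by auto
  then show ?thesis
    using gdist_le[OF gpath_segment[of e 0 "w e"]] assms by (simp add: edge_point_def)
qed

lemma Vertex_gpoints: "v \<in> verts G \<Longrightarrow> Vertex v \<in> gpoints G w"
  by (simp add: gpoints_def)

lemma gdist_self: "x \<in> gpoints G w \<Longrightarrow> gdist G w x x = 0"
  using gdist_le[of G w x "[]" x] gdist_nonneg[of x x] by auto

lemma gdiam_nonneg: "0 \<le> gdiam G w"
proof -
  obtain v where "v \<in> verts G"
    using connected by (auto simp: Digraph_Component.connected_def strongly_connected_def)
  then show ?thesis
    using gdist_le_gdiam[of "Vertex v" "Vertex v"] gdist_self[of "Vertex v"] Vertex_gpoints by auto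
qed

end

section \<open>Heights over a root\<close>

locale rooted_metric_graph = metric_graph +
  fixes r :: 'a
  assumes root_verts: "r \<in> verts G"
begin

definition ht :: "'a \<Rightarrow> real" where
  "ht v = gdist G w (Vertex r) (Vertex v)"

lemma ht_root: "ht r = 0"
  using root_verts by (simp add: ht_def gdist_self Vertex_gpoints)

lemma ht_arc:
  assumes "e \<in> arcs G"
  shows "\<bar>ht (tail G e) - ht (head G e)\<bar> \<le> w e"
proof -
  have t: "gdist G w (Vertex r) (Vertex b) \<le> gdist G w (Vertex r) (Vertex a) + gdist G w (Vertex a) (Vertex b)"
    if "a \<in> verts G" "b \<in> verts G" for a b
    using that root_verts by (intro gdist_triangle Vertex_gpoints)
  show ?thesis
    using t[of "tail G e" "head G e"] t[of "head G e" "tail G e"] gdist_arc_le[OF assms]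
      gdist_commute[of "Vertex (tail G e)"] assms by (simp add: ht_def abs_le_iff)
qed

text \<open>If no arc at \<open>v\<close> were tight, raising \<open>ht v\<close> by a small
  \<open>\<epsilon>\<close> would keep the heights 1-Lipschitz along all arcs and so force
  \<open>v\<close> to be farther from the root than \<open>ht v\<close>.\<close>

lemma parent_exists:
  assumes "v \<in> verts G" "v \<noteq> r"
  shows "\<exists>e u. e \<in> arcs G \<and> u \<in> verts G \<and> {tail G e, head G e} = {u, v} \<and> ht v = ht u + w e"
proof (rule ccontr)
  assume no: "\<not> ?thesis"
  define gap where "gap e = (if head G e = v then w e + ht (tail G e) - ht v else w e + ht (head G e) - ht v)" for e
  define X where "X = {e \<in> arcs G. v \<in> {tail G e, head G e}}"
  have gap: "0 < gap e" if "e \<in> X" for e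
  proof -
    have e: "e \<in> arcs G" "tail G e \<in> verts G" "head G e \<in> verts G" using that by (auto simp: X_def)
    then have "ht v \<noteq> ht u + w e" if "{tail G e, head G e} = {u, v}" "u \<in> verts G" for u
      using no that by blast
    then show ?thesis
      using that e ht_arc[OF e(1)] by (force simp: gap_def X_def insert_commute)
  qed
  define \<epsilon> where "\<epsilon> = Min (insert 1 (gap ` X))"
  have "finite X" by (simp add: X_def)
  then have \<epsilon>: "0 < \<epsilon>" "\<And>e. e \<in> X \<Longrightarrow> \<epsilon> \<le> gap e"
    using gap by (auto simp: \<epsilon>_def)
  define \<Psi> where "\<Psi> = ht(v := ht v + \<epsilon>)"
  have lip: "\<bar>\<Psi> (tail G e) - \<Psi> (head G e)\<bar> \<le> w e" if e: "e \<in> arcs G" for e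
  proof (cases "e \<in> X")
    case True
    then show ?thesis
      using \<epsilon>(1) \<epsilon>(2)[OF True] ht_arc[OF e] edge_pos[OF e]
      by (auto simp: \<Psi>_def gap_def X_def split: if_splits)
  next
    case False
    then show ?thesis using ht_arc[OF e] e by (auto simp: \<Psi>_def X_def)
  qed
  have "\<Psi> v - \<Psi> r \<le> ht v"
    unfolding ht_def
    using gdist_ge_potential[of "\<lambda>e s. min (\<Psi> (tail G e) + s) (\<Psi> (head G e) + (w e - s))" \<Psi>
        "Vertex r" "Vertex v"] lip assms root_verts Vertex_gpoints
    by (fastforce simp: abs_le_iff min_def)
  then show False using assms \<epsilon>(1) ht_root by (simp add: \<Psi>_def)
qed

end

section \<open>Geodesic tree and cut arcs\<close>

locale geodesic_tree = rooted_metric_graph +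
  fixes pa :: "'a \<Rightarrow> 'b" and po :: "'a \<Rightarrow> 'a"
  assumes parent: "v \<in> verts G \<Longrightarrow> v \<noteq> r \<Longrightarrow>
    pa v \<in> arcs G \<and> po v \<in> verts G \<and> {tail G (pa v), head G (pa v)} = {po v, v} \<and> ht v = ht (po v) + w (pa v)"
begin

definition cuts :: "'b set" where
  "cuts = arcs G - pa ` (verts G - {r})"

text \<open>
  Every arc \<open>e\<close> outside the tree is cut at its highest point, at parameter \<open>peak e\<close>.  The peak may
  coincide with the upper end; since \<open>node_par\<close> has to descend strictly, it goes to the lower end.
\<close>

definition peak :: "'b \<Rightarrow> real" where
  "peak e = (w e + ht (head G e) - ht (tail G e)) / 2"

definition lower_end :: "'b \<Rightarrow> 'a" where
  "lower_end e = (if ht (tail G e) \<le> ht (head G e) then tail G e else head G e)"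

definition upper_end :: "'b \<Rightarrow> 'a" where
  "upper_end e = (if ht (tail G e) \<le> ht (head G e) then head G e else tail G e)"

definition nodes :: "('a + 'b) set" where
  "nodes = Inl ` verts G \<union> Inr ` cuts"

definition node_ht :: "'a + 'b \<Rightarrow> real" where
  "node_ht = case_sum ht (\<lambda>e. ht (tail G e) + peak e)"

definition node_par :: "'a + 'b \<Rightarrow> 'a + 'b" where
  "node_par = case_sum (Inl \<circ> po) (Inl \<circ> lower_end)"

definition node_oth :: "'a + 'b \<Rightarrow> 'a + 'b" where
  "node_oth = case_sum Inl (Inl \<circ> upper_end)"

definition node_point :: "'a + 'b \<Rightarrow> ('a, 'b) gpoint" where
  "node_point = case_sum Vertex (\<lambda>e. edge_point G w e (peak e))"

abbreviation node_edges where
  "node_edges \<equiv> descents nodes (Inl r) node_par (Inr ` cuts) node_oth"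

lemma parent_pos: "v \<in> verts G \<Longrightarrow> v \<noteq> r \<Longrightarrow> 0 < w (pa v)"
  using parent edge_pos by blast

lemma parent_cases:
  assumes "v \<in> verts G" "v \<noteq> r"
  obtains "tail G (pa v) = v" "head G (pa v) = po v" "po v \<noteq> v"
    | "tail G (pa v) = po v" "head G (pa v) = v" "po v \<noteq> v"
proof -
  have "po v \<noteq> v" using parent[OF assms] parent_pos[OF assms] by force
  then show thesis using that parent[OF assms] by (metis doubleton_eq_iff)
qed

text \<open>Two vertices sharing a parent arc would be each other's parent, hence each strictly
  higher than the other.\<close>

lemma inj_on_pa: "inj_on pa (verts G - {r})"
proof (rule inj_onI, rule ccontr)
  fix u v assume u: "u \<in> verts G - {r}" and v: "v \<in> verts G - {r}" and eq: "pa u = pa v" "u \<noteq> v"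
  then have "{po u, u} = {po v, v}" using parent[of u] parent[of v] by auto
  then have "po u = v" "po v = u" using eq by (auto simp: doubleton_eq_iff)
  then show False using parent[of u] parent[of v] parent_pos[of u] u v eq by auto
qed

lemma cuts_arcs: "e \<in> cuts \<Longrightarrow> e \<in> arcs G"
  by (simp add: cuts_def)

lemma arc_cases:
  assumes "e \<in> arcs G"
  obtains "e \<in> cuts" | v where "v \<in> verts G" "v \<noteq> r" "e = pa v" "e \<notin> cuts"
  using assms by (auto simp: cuts_def)

lemma peak_bounds:
  assumes "e \<in> arcs G"
  shows "0 \<le> peak e" "peak e \<le> w e"
  using ht_arc[OF assms] by (auto simp: peak_def abs_le_iff)

lemma peak_sum: "ht (tail G e) + peak e = ht (head G e) + (w e - peak e)"
  by (simp add: peak_def field_simps)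

lemma lower_end_less:
  assumes "e \<in> arcs G"
  shows "ht (lower_end e) < ht (tail G e) + peak e"
  using edge_pos[OF assms] by (auto simp: lower_end_def peak_def field_simps)

lemma upper_end_le:
  assumes "e \<in> arcs G"
  shows "ht (upper_end e) \<le> ht (tail G e) + peak e"
  using ht_arc[OF assms] by (auto simp: upper_end_def peak_def field_simps abs_le_iff)

lemma node_edges_iff:
  "(x, y) \<in> node_edges \<longleftrightarrow> (\<exists>v\<in>verts G - {r}. x = Inl v \<and> y = Inl (po v)) \<or>
    (\<exists>e\<in>cuts. x = Inr e \<and> (y = Inl (tail G e) \<or> y = Inl (head G e)))"
  by (auto simp: descents_def nodes_def node_par_def node_oth_def lower_end_def upper_end_def split: if_splits)

lemma node_point_gpoints: "x \<in> nodes \<Longrightarrow> node_point x \<in> gpoints G w"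
  using Vertex_gpoints edge_point_in peak_bounds cuts_arcs
  by (auto simp: nodes_def node_point_def)

text \<open>Establishes the assumption \<open>diam\<close>: extend \<open>\<Psi>\<close> to the
  whole metric graph and compare its values at the point of height \<open>\<phi>\<close> and at
  \<open>y\<close>, whose distance is at most the diameter.\<close>

lemma node_diam:
  assumes lip: "\<And>v u. (v, u) \<in> node_edges \<Longrightarrow> \<bar>\<Psi> v - \<Psi> u\<bar> \<le> node_ht v - node_ht u"
    and e: "(v, u) \<in> node_edges" and \<phi>: "node_ht u \<le> \<phi>" "\<phi> \<le> node_ht v" and y: "y \<in> nodes"
  shows "min (\<Psi> v + (node_ht v - \<phi>)) (\<Psi> u + (\<phi> - node_ht u)) \<le> \<Psi> y + gdiam G w"
proof -
  \<comment> \<open>The largest 1-Lipschitz extension: a minimum of cones over the nodes on the arc,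
    including the peak of a cut arc.\<close>
  define \<Phi> where "\<Phi> e s = (let m = min (\<Psi> (Inl (tail G e)) + s) (\<Psi> (Inl (head G e)) + (w e - s)) in
    if e \<in> cuts then min m (\<Psi> (Inr e) + \<bar>s - peak e\<bar>) else m)" for e s
  define F where "F = case_gpoint (\<lambda>v. \<Psi> (Inl v)) \<Phi>"
  have cut: "\<bar>\<Psi> (Inr e) - \<Psi> (Inl (tail G e))\<bar> \<le> peak e" "\<bar>\<Psi> (Inr e) - \<Psi> (Inl (head G e))\<bar> \<le> w e - peak e"
    if "e \<in> cuts" for e
    using that lip[of "Inr e" "Inl (tail G e)"] lip[of "Inr e" "Inl (head G e)"] peak_sum[of e]
    by (auto simp: node_edges_iff node_ht_def)
  have arc: "\<bar>\<Psi> (Inl (tail G e)) - \<Psi> (Inl (head G e))\<bar> \<le> w e" if "e \<in> arcs G" for e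
    using that
  proof (cases rule: arc_cases)
    case 1
    then show ?thesis using cut[of e] by linarith
  next
    case (2 v)
    then have "\<bar>\<Psi> (Inl v) - \<Psi> (Inl (po v))\<bar> \<le> w (pa v)"
      using lip[of "Inl v" "Inl (po v)"] parent[of v] by (auto simp: node_edges_iff node_ht_def)
    then show ?thesis using parent_cases[of v] 2 by (metis abs_minus_commute)
  qed
  have ends: "\<Phi> e 0 = \<Psi> (Inl (tail G e)) \<and> \<Phi> e (w e) = \<Psi> (Inl (head G e))" if "e \<in> arcs G" for e
    using cut[of e] arc[of e] peak_bounds[of e] that by (auto simp: \<Phi>_def Let_def abs_le_iff)
  have \<Phi>_lip: "\<Phi> e t - \<Phi> e s \<le> \<bar>t - s\<bar>" for e s t
    by (auto simp: \<Phi>_def Let_def min_def abs_if)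
  have F_edge: "F (edge_point G w e s) = \<Phi> e s" if "e \<in> arcs G" for e s
    using ends[OF that] by (auto simp: F_def edge_point_def)
  have F_node: "F (node_point y) = \<Psi> y"
  proof (cases y)
    case (Inr e)
    then have "e \<in> cuts" using y by (auto simp: nodes_def)
    then show ?thesis
      using Inr cut[of e] peak_bounds[of e] F_edge[of e] cuts_arcs[of e]
      by (auto simp: node_point_def \<Phi>_def Let_def abs_le_iff)
  qed (simp add: F_def node_point_def)
  \<comment> \<open>The point at height \<open>\<phi>\<close> on the edge from \<open>v\<close> to
    \<open>u\<close>.\<close>
  obtain e s where s: "e \<in> arcs G" "s \<in> {0..w e}"
    "min (\<Psi> v + (node_ht v - \<phi>)) (\<Psi> u + (\<phi> - node_ht u)) \<le> \<Phi> e s"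
  proof -
    from e consider a where "a \<in> verts G" "a \<noteq> r" "v = Inl a" "u = Inl (po a)"
      | e where "e \<in> cuts" "v = Inr e" "u = Inl (tail G e)"
      | e where "e \<in> cuts" "v = Inr e" "u = Inl (head G e)"
      by (auto simp: node_edges_iff)
    then show thesis
    proof cases
      case 1
      have a: "pa a \<in> arcs G" "pa a \<notin> cuts" "ht a = ht (po a) + w (pa a)"
        using parent 1 by (auto simp: cuts_def)
      have b: "ht (po a) \<le> \<phi>" "\<phi> \<le> ht a" using 1 \<phi> by (auto simp: node_ht_def)
      from 1(1,2) show thesis
      proof (cases rule: parent_cases)
        case 1
        have "\<Phi> (pa a) (ht a - \<phi>) = min (\<Psi> v + (node_ht v - \<phi>)) (\<Psi> u + (\<phi> - node_ht u))"
          using 1 a \<open>v = Inl a\<close> \<open>u = Inl (po a)\<close> by (simp add: \<Phi>_def node_ht_def algebra_simps)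
        then show thesis using a b by (intro that[of "pa a" "ht a - \<phi>"]) auto
      next
        case 2
        have "\<Phi> (pa a) (\<phi> - ht (po a)) = min (\<Psi> v + (node_ht v - \<phi>)) (\<Psi> u + (\<phi> - node_ht u))"
          using 2 a \<open>v = Inl a\<close> \<open>u = Inl (po a)\<close>
          by (simp add: \<Phi>_def node_ht_def algebra_simps min.commute)
        then show thesis using a b by (intro that[of "pa a" "\<phi> - ht (po a)"]) auto
      qed
    next
      case 2
      define s where "s = \<phi> - ht (tail G e)"
      have s: "0 \<le> s" "s \<le> peak e" "node_ht v - \<phi> = peak e - s" "\<phi> - node_ht u = s"
        using 2 \<phi> by (auto simp: s_def node_ht_def)
      have "\<Psi> v + (peak e - s) \<le> \<Psi> (Inl (head G e)) + (w e - s)"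
        using cut[of e] 2 by (simp add: abs_le_iff)
      then have "min (\<Psi> v + (peak e - s)) (\<Psi> u + s) \<le> \<Phi> e s"
        using 2 s by (simp add: \<Phi>_def Let_def min_le_iff_disj)
      then show thesis
        using that[of e s] 2 s peak_bounds[of e] cuts_arcs[of e] by simp
    next
      case 3
      define s where "s = peak e + (node_ht v - \<phi>)"
      have s: "peak e \<le> s" "s \<le> w e" "node_ht v - \<phi> = s - peak e" "\<phi> - node_ht u = w e - s"
        using 3 \<phi> peak_sum[of e] by (auto simp: s_def node_ht_def)
      have "\<Psi> v + (s - peak e) \<le> \<Psi> (Inl (tail G e)) + s"
        using cut[of e] 3 by (simp add: abs_le_iff)
      then have "min (\<Psi> v + (s - peak e)) (\<Psi> u + (w e - s)) \<le> \<Phi> e s"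
        using 3 s by (simp add: \<Phi>_def Let_def min_le_iff_disj)
      then show thesis
        using that[of e s] 3 s peak_bounds[of e] cuts_arcs[of e] by simp
    qed
  qed
  have "F (edge_point G w e s) - F (node_point y) \<le> gdist G w (node_point y) (edge_point G w e s)"
    unfolding F_def
    by (rule gdist_ge_potential) (use \<Phi>_lip ends node_point_gpoints y edge_point_in s in auto)
  also have "\<dots> \<le> gdiam G w"
    by (rule gdist_le_gdiam) (use node_point_gpoints y edge_point_in s in auto)
  finally show ?thesis using F_edge s F_node by simp
qed

sublocale height_graph nodes "Inl r" node_par "Inr ` cuts" node_oth node_ht "gdiam G w"
proof
  show "finite nodes" by (simp add: nodes_def cuts_def)
  show "Inl r \<in> nodes" "node_ht (Inl r) = 0"
    using root_verts ht_root by (auto simp: nodes_def node_ht_def)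
  show "node_par x \<in> nodes \<and> node_ht (node_par x) < node_ht x" if "x \<in> nodes" "x \<noteq> Inl r" for x
    using that parent parent_pos lower_end_less cuts_arcs
    by (fastforce simp: nodes_def node_ht_def node_par_def lower_end_def)
  show "Inr ` cuts \<subseteq> nodes - {Inl r}" by (auto simp: nodes_def)
  show "node_oth c \<in> nodes \<and> node_ht (node_oth c) \<le> node_ht c" if "c \<in> Inr ` cuts" for c
    using that upper_end_le cuts_arcs
    by (auto simp: nodes_def node_ht_def node_oth_def upper_end_def)
  show "0 \<le> gdiam G w" by (rule gdiam_nonneg)
qed (rule node_diam)

section \<open>Cyclomatic number, length and leaves\<close>

lemma card_cuts: "int (card cuts) = cyc G"
proof -
  have "card (pa ` (verts G - {r})) = card (verts G) - 1"
    using inj_on_pa root_verts by (simp add: card_image)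
  moreover have "pa ` (verts G - {r}) \<subseteq> arcs G" using parent by auto
  moreover have "0 < card (verts G)" using root_verts by (auto simp: card_gt_0_iff)
  ultimately show ?thesis
    using card_mono[of "arcs G" "pa ` (verts G - {r})"]
    by (simp add: cuts_def cyc_def card_Diff_subset of_nat_diff)
qed

text \<open>A tree arc is the descent from a vertex to its parent; a cut arc splits at its peak into
  two descents that add up to \<open>w e\<close>.\<close>

lemma glen_eq:
  "glen G w = (\<Sum>x\<in>nodes - {Inl r}. node_ht x - node_ht (node_par x))
    + (\<Sum>c\<in>Inr ` cuts. node_ht c - node_ht (node_oth c))"
proof -
  have "nodes - {Inl r} = Inl ` (verts G - {r}) \<union> Inr ` cuts" by (auto simp: nodes_def)
  then have "(\<Sum>x\<in>nodes - {Inl r}. node_ht x - node_ht (node_par x)) =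
      (\<Sum>v\<in>verts G - {r}. ht v - ht (po v)) + (\<Sum>e\<in>cuts. ht (tail G e) + peak e - ht (lower_end e))"
    by (simp, subst sum.union_disjoint)
      (auto simp: sum.reindex cuts_def node_ht_def node_par_def)
  moreover have "(\<Sum>c\<in>Inr ` cuts. node_ht c - node_ht (node_oth c)) =
      (\<Sum>e\<in>cuts. ht (tail G e) + peak e - ht (upper_end e))"
    by (simp add: sum.reindex node_ht_def node_oth_def)
  moreover have "(\<Sum>e\<in>cuts. ht (tail G e) + peak e - ht (lower_end e)) +
      (\<Sum>e\<in>cuts. ht (tail G e) + peak e - ht (upper_end e)) = sum w cuts"
    unfolding sum.distrib[symmetric]
    by (intro sum.cong) (auto simp: lower_end_def upper_end_def peak_def field_simps)
  moreover have "(\<Sum>v\<in>verts G - {r}. ht v - ht (po v)) = sum w (pa ` (verts G - {r}))"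
    using inj_on_pa parent by (auto simp: sum.reindex intro!: sum.cong)
  moreover have "glen G w = sum w cuts + sum w (pa ` (verts G - {r}))"
    unfolding glen_def cuts_def using parent by (intro sum.subset_diff) auto
  ultimately show ?thesis by simp
qed

text \<open>\<open>pa v\<close> is not a loop, so as the only arc at \<open>v\<close> it would give
  degree exactly one.\<close>

lemma other_arc_exists:
  assumes v: "v \<in> verts G" "v \<noteq> r" "gdegree G v \<noteq> 1"
  shows "\<exists>e\<in>arcs G. e \<noteq> pa v \<and> v \<in> {tail G e, head G e}"
proof (rule ccontr)
  assume no: "\<not> ?thesis"
  then have only: "e = pa v" if "e \<in> arcs G" "tail G e = v \<or> head G e = v" for e
    using that by auto
  have "pa v \<in> arcs G" using parent v by blast
  have "in_arcs G v \<subseteq> {pa v}" "out_arcs G v \<subseteq> {pa v}"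
    using only by (metis in_in_arcs_conv in_out_arcs_conv singletonI subsetI)+
  then have "in_arcs G v = (if pa v \<in> in_arcs G v then {pa v} else {})"
    "out_arcs G v = (if pa v \<in> out_arcs G v then {pa v} else {})"
    by (auto simp del: in_in_arcs_conv in_out_arcs_conv)
  then have "in_arcs G v = (if head G (pa v) = v then {pa v} else {})"
    "out_arcs G v = (if tail G (pa v) = v then {pa v} else {})"
    using \<open>pa v \<in> arcs G\<close> by simp_all
  with v(1,2) have "gdegree G v = 1"
    by (cases rule: parent_cases) (auto simp: gdegree_def in_degree_def out_degree_def)
  then show False using v by simp
qed

text \<open>A further arc at \<open>v\<close> is either cut, with an edge from its peak to
  \<open>v\<close>, or the parent arc of a child of \<open>v\<close>.\<close>

lemma ascent_exists:
  assumes v: "v \<in> verts G" "v \<noteq> r" "gdegree G v \<noteq> 1"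
  shows "\<exists>x. (x, Inl v) \<in> node_edges"
proof -
  obtain e where e: "e \<in> arcs G" "e \<noteq> pa v" "v \<in> {tail G e, head G e}"
    using other_arc_exists[OF v] by blast
  from e(1) show ?thesis
  proof (cases rule: arc_cases)
    case 1
    then show ?thesis using e by (auto simp: node_edges_iff intro!: exI[of _ "Inr e"])
  next
    case (2 u)
    then have "v = po u" using e parent[of u] by auto
    then show ?thesis using 2 by (auto simp: node_edges_iff)
  qed
qed

text \<open>The root is a leaf if there is any, so the tops in \<open>L\<close> are one fewer than
  the leaves; this accounts for \<open>card L + 1\<close> in
  \<open>total_descent_le\<close>.\<close>

lemma glen_le:
  assumes "\<And>v. v \<in> verts G \<Longrightarrow> gdegree G v = 1 \<Longrightarrow> gdegree G r = 1"
  shows "glen G w \<le> (real_of_int (cyc G) + max 1 (real (num_leaves G) / 2)) * gdiam G w"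
proof -
  define leaves where "leaves = {v \<in> verts G. gdegree G v = 1}"
  define L where "L = (Inl ` (leaves - {r}) :: ('a + 'b) set)"
  have "glen G w \<le> (real (card (Inr ` cuts :: ('a + 'b) set)) + max 1 ((real (card L) + 1) / 2)) * gdiam G w"
    unfolding glen_eq
  proof (rule total_descent_le)
    show "L \<subseteq> nodes - {Inl r}" by (auto simp: L_def leaves_def nodes_def)
    show "\<exists>u. (u, x) \<in> node_edges" if "x \<in> nodes - {Inl r} - Inr ` cuts - L" for x
      using that ascent_exists by (auto simp: L_def leaves_def nodes_def)
  qed
  moreover have "card (Inr ` cuts :: ('a + 'b) set) = card cuts" by (simp add: card_image)
  moreover have "max 1 ((real (card L) + 1) / 2) \<le> max 1 (real (num_leaves G) / 2)"
  proof (cases "leaves = {}")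
    case False
    then have "r \<in> leaves" using assms root_verts by (auto simp: leaves_def)
    moreover have "finite leaves" by (simp add: leaves_def)
    ultimately have "card leaves = Suc (card (leaves - {r}))" by (intro card.remove)
    then have "real (num_leaves G) = real (card L) + 1"
      by (simp add: L_def card_image num_leaves_def leaves_def)
    then show ?thesis by simp
  qed (simp add: L_def)
  then have "(real (card cuts) + max 1 ((real (card L) + 1) / 2)) * gdiam G w
      \<le> (real (card cuts) + max 1 (real (num_leaves G) / 2)) * gdiam G w"
    using gdiam_nonneg by (intro mult_right_mono add_left_mono)
  moreover have "real_of_int (cyc G) = real (card cuts)" by (simp flip: card_cuts)
  ultimately show ?thesis by simp
qed

end

theorem theorem2:
  fixes G :: "('a, 'b) pre_digraph" and w :: "'b \<Rightarrow> real"
  assumes "metric_graph G w"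
  shows "glen G w \<le> (real_of_int (cyc G) + max 1 (real (num_leaves G) / 2)) * gdiam G w"
proof -
  interpret metric_graph G w by fact
  obtain v0 where "v0 \<in> verts G"
    using connected by (auto simp: Digraph_Component.connected_def strongly_connected_def)
  \<comment> \<open>Any leaf serves as \<open>r\<close>, and \<open>v0\<close> does if there is
    none.\<close>
  then obtain r where r: "r \<in> verts G" "\<And>v. v \<in> verts G \<Longrightarrow> gdegree G v = 1 \<Longrightarrow> gdegree G r = 1"
    by blast
  interpret rooted_metric_graph G w r by standard (rule r)
  obtain pa po where "\<And>v. v \<in> verts G \<Longrightarrow> v \<noteq> r \<Longrightarrow> pa v \<in> arcs G \<and> po v \<in> verts G \<and>
      {tail G (pa v), head G (pa v)} = {po v, v} \<and> ht v = ht (po v) + w (pa v)"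
    using parent_exists by metis
  then interpret geodesic_tree G w r pa po by unfold_locales
  show ?thesis using r(2) by (rule glen_le)
qed

end
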